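(* Let $K$ be a field, $S=K[x_1,\ldots,x_n]$, and let $I\subset S$ be a nonzero monomial ideal of intersection type with presentation $I=\bigcap_{\mathfrak p\in\operatorname{Ass}(S/I)}\mathfrak p^{d_{\mathfrak p}}$. Then the following statements hold: (a) $d_{\mathfrak p}\leq\operatorname{reg}(I(\mathfrak p))$ for all $\mathfrak p\in\operatorname{Ass}(S/I)$; (b) for $\mathfrak p\in\operatorname{Ass}(S/I)$, $d_{\mathfrak p}=\operatorname{reg}(I(\mathfrak p))$ if and only if $I(\mathfrak p)$ has a linear resolution. In particular, $I=\bigcap_{\mathfrak p\in\operatorname{Ass}(S/I)}\mathfrak p^{\operatorname{reg}(I(\mathfrak p))}$ if and only if $I(\mathfrak p)$ has a linear resolution for all $\mathfrak p\in\operatorname{Ass}(S/I)$.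
   Context: A monomial prime ideal of $S$ is a prime ideal generated by a subset of the variables; associated primes of $S/I$, $I$ a monomial ideal, are of this form. A monomial ideal $I\subset S$ is of intersection type if it is an intersection of powers (with positive integer exponents; the empty intersection is $S$) of monomial prime ideals. Such an ideal has a unique irredundant presentation of this form, and the primes occurring in it are exactly those in $\operatorname{Ass}(S/I)$. For a monomial prime ideal $\mathfrak p$, $S(\mathfrak p)$ denotes the polynomial ring over $K$ in the variables which belong to $\mathfrak p$, and the monomial localization $I(\mathfrak p)\subset S(\mathfrak p)$ is the image of $I$ under the $K$-algebra homomorphism $S\to S(\mathfrak p)$ with $x_i\mapsto x_i$ if $x_i\in\mathfrak p$ and $x_i\mapsto1$ otherwise. $\operatorname{reg}$ denotes Castelnuovo–Mumford regularity over $S(\mathfrak p)$ (standard grading). A graded ideal has a linear resolution if it is generated in a single degree $d$ and its regularity equals $d$. *)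

theory Defs
  imports "HOL-Algebra.Ideal_Product" "HOL-Algebra.QuotRing" "HOL-Library.Poly_Mapping"
begin

section \<open>Polynomial rings\<close>

text \<open>Exponent vectors are finitely supported functions on \<^typ>\<open>nat\<close>, the set of all variable
  indices. The ring \<open>poly_ring X\<close> consists of the polynomials in the variables indexed by \<open>X\<close>,
  so that \<open>K[x\<^sub>1,\<dots>,x\<^sub>n]\<close> is \<open>poly_ring {1..n}\<close> and each \<open>S(\<pp>)\<close> is a subring of it.\<close>

type_synonym 'k mpoly = "(nat \<Rightarrow>\<^sub>0 nat) \<Rightarrow>\<^sub>0 'k"

definition Const :: "'k::comm_ring_1 \<Rightarrow> 'k mpoly" where
  "Const c = Poly_Mapping.single 0 c"

definition Var :: "nat \<Rightarrow> 'k::comm_ring_1 mpoly" where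
  "Var i = Poly_Mapping.single (Poly_Mapping.single i 1) 1"

definition indets :: "'k::comm_ring_1 mpoly \<Rightarrow> nat set" where
  "indets f = (\<Union>m\<in>Poly_Mapping.keys f. Poly_Mapping.keys m)"

definition poly_ring :: "nat set \<Rightarrow> 'k::comm_ring_1 mpoly ring" where
  "poly_ring X =
     \<lparr>carrier = {f. indets f \<subseteq> X}, mult = (*), one = 1, zero = 0, add = (+)\<rparr>"

definition mon_deg :: "(nat \<Rightarrow>\<^sub>0 nat) \<Rightarrow> nat" where
  "mon_deg m = (\<Sum>i\<in>Poly_Mapping.keys m. Poly_Mapping.lookup m i)"

definition homogeneous :: "nat \<Rightarrow> 'k::comm_ring_1 mpoly \<Rightarrow> bool" where
  "homogeneous e f \<longleftrightarrow> (\<forall>m\<in>Poly_Mapping.keys f. mon_deg m = e)"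

text \<open>The \<open>K\<close>-algebra homomorphism with \<open>x\<^sub>i \<mapsto> g i\<close>.\<close>

definition alg_hom :: "(nat \<Rightarrow> 'k mpoly) \<Rightarrow> 'k::comm_ring_1 mpoly \<Rightarrow> 'k mpoly" where
  "alg_hom g f = (\<Sum>m\<in>Poly_Mapping.keys f. Const (Poly_Mapping.lookup f m) *
     (\<Prod>i\<in>Poly_Mapping.keys m. g i ^ Poly_Mapping.lookup m i))"

lemma cring_poly_ring: "cring (poly_ring X :: 'k::comm_ring_1 mpoly ring)"
proof -
  have ind_add: "indets (f + g) \<subseteq> X" if "indets f \<subseteq> X" "indets g \<subseteq> X" for f g :: "'k mpoly"
    using that Poly_Mapping.keys_add[of f g] unfolding indets_def by blast
  have ind_mult: "indets (f * g) \<subseteq> X" if "indets f \<subseteq> X" "indets g \<subseteq> X" for f g :: "'k mpoly"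
  proof
    fix i assume "i \<in> indets (f * g)"
    then obtain m where "m \<in> Poly_Mapping.keys (f * g)" and i: "i \<in> Poly_Mapping.keys m"
      by (auto simp: indets_def)
    then obtain a b where "a \<in> Poly_Mapping.keys f" "b \<in> Poly_Mapping.keys g" "m = a + b"
      using keys_mult[of f g] by blast
    with i show "i \<in> X"
      using that Poly_Mapping.keys_add[of a b] unfolding indets_def by blast
  qed
  show ?thesis
  proof (rule cringI)
    show "abelian_group (poly_ring X :: 'k mpoly ring)"
    proof (rule abelian_groupI)
      fix f :: "'k mpoly" assume "f \<in> carrier (poly_ring X)"
      then have "- f \<in> carrier (poly_ring X)" by (simp add: poly_ring_def indets_def)
      then show "\<exists>g\<in>carrier (poly_ring X). g \<oplus>\<^bsub>poly_ring X\<^esub> f = \<zero>\<^bsub>poly_ring X\<^esub>"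
        by (intro bexI[of _ "- f"]) (simp_all add: poly_ring_def)
    qed (auto simp: poly_ring_def ind_add algebra_simps indets_def[of 0])
    show "Group.comm_monoid (poly_ring X :: 'k mpoly ring)"
      by (rule comm_monoidI)
         (auto simp: poly_ring_def ind_mult algebra_simps indets_def[of 1] split: if_splits)
  qed (simp add: poly_ring_def algebra_simps)
qed

section \<open>Monomial ideals, associated primes, ideals of intersection type\<close>

definition monomial_ideal :: "nat set \<Rightarrow> 'k::comm_ring_1 mpoly set \<Rightarrow> bool" where
  "monomial_ideal X I \<longleftrightarrow>
     (\<exists>M. (\<forall>m\<in>M. Poly_Mapping.keys m \<subseteq> X) \<and>
          I = Idl\<^bsub>poly_ring X\<^esub> ((\<lambda>m. Poly_Mapping.single m 1) ` M))"

definition monomial_prime :: "nat set \<Rightarrow> 'k::comm_ring_1 mpoly set \<Rightarrow> bool" where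
  "monomial_prime X P \<longleftrightarrow>
     primeideal P (poly_ring X) \<and> (\<exists>A\<subseteq>X. P = Idl\<^bsub>poly_ring X\<^esub> (Var ` A))"

text \<open>\<open>Ass(R/I)\<close>: the prime ideals of \<open>R\<close> that are annihilators of an element of the
  \<open>R\<close>-module \<open>R/I\<close>.\<close>

definition Ass :: "('a, 'b) ring_scheme \<Rightarrow> 'a set \<Rightarrow> 'a set set" where
  "Ass R I = {P. primeideal P R \<and> (\<exists>u\<in>carrier (R Quot I).
     P = {g \<in> carrier R. (I +>\<^bsub>R\<^esub> g) \<otimes>\<^bsub>R Quot I\<^esub> u = \<zero>\<^bsub>R Quot I\<^esub>})}"

abbreviation ideal_pow :: "('a, 'b) ring_scheme \<Rightarrow> 'a set \<Rightarrow> nat \<Rightarrow> 'a set" where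
  "ideal_pow R P e \<equiv> P [^]\<^bsub>ideals_set R\<^esub> e"

text \<open>Intersections are taken inside the ring, so that the empty intersection is the ring.\<close>

definition intersection_type :: "nat set \<Rightarrow> 'k::comm_ring_1 mpoly set \<Rightarrow> bool" where
  "intersection_type X I \<longleftrightarrow>
     (\<exists>F. finite F \<and> (\<forall>(P, e)\<in>F. monomial_prime X P \<and> e \<ge> 1) \<and>
          I = carrier (poly_ring X) \<inter> (\<Inter>(P, e)\<in>F. ideal_pow (poly_ring X) P e))"

definition vars_of :: "nat set \<Rightarrow> 'k::comm_ring_1 mpoly set \<Rightarrow> nat set" where
  "vars_of X P = {i\<in>X. Var i \<in> P}"

definition mon_localization ::
    "'k::comm_ring_1 mpoly set \<Rightarrow> 'k mpoly set \<Rightarrow> 'k mpoly set" where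
  "mon_localization P I = alg_hom (\<lambda>i. if Var i \<in> P then Var i else 1) ` I"

section \<open>Regularity\<close>

text \<open>A candidate for a graded free resolution of an ideal \<open>J\<close>: the module \<open>F\<^sub>i\<close> is
  \<open>\<Oplus>\<^sub>k S(-shift i k)\<close> with \<open>k < rank i\<close>; row \<open>k\<close> of the matrix \<open>diff i\<close> is the image of the
  \<open>k\<close>-th basis element under \<open>F\<^sub>i\<^sub>+\<^sub>1 \<rightarrow> F\<^sub>i\<close>, and \<open>aug k\<close> is the image of the \<open>k\<close>-th basis element
  under \<open>F\<^sub>0 \<rightarrow> J\<close>. Shifts are natural numbers because \<open>J\<close> lives in nonnegative degrees.\<close>

record 'p free_res =
  rank :: "nat \<Rightarrow> nat"
  shift :: "nat \<Rightarrow> nat \<Rightarrow> nat"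
  diff :: "nat \<Rightarrow> nat \<Rightarrow> nat \<Rightarrow> 'p"
  aug :: "nat \<Rightarrow> 'p"

definition free_mod :: "nat set \<Rightarrow> nat \<Rightarrow> (nat \<Rightarrow> 'k::comm_ring_1 mpoly) set" where
  "free_mod X r = {v. (\<forall>k<r. v k \<in> carrier (poly_ring X)) \<and> (\<forall>k\<ge>r. v k = 0)}"

definition diff_map ::
    "'k::comm_ring_1 mpoly free_res \<Rightarrow> nat \<Rightarrow> (nat \<Rightarrow> 'k mpoly) \<Rightarrow> (nat \<Rightarrow> 'k mpoly)" where
  "diff_map F i v =
     (\<lambda>l. if l < rank F i then \<Sum>k<rank F (Suc i). v k * diff F i k l else 0)"

definition aug_map :: "'k::comm_ring_1 mpoly free_res \<Rightarrow> (nat \<Rightarrow> 'k mpoly) \<Rightarrow> 'k mpoly" where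
  "aug_map F v = (\<Sum>k<rank F 0. v k * aug F k)"

definition graded_free_resolution ::
    "nat set \<Rightarrow> 'k::comm_ring_1 mpoly set \<Rightarrow> 'k mpoly free_res \<Rightarrow> bool" where
  "graded_free_resolution X J F \<longleftrightarrow>
     \<comment> \<open>the maps are defined over the polynomial ring and homogeneous of degree 0\<close>
     (\<forall>k<rank F 0. aug F k \<in> carrier (poly_ring X) \<and> homogeneous (shift F 0 k) (aug F k)) \<and>
     (\<forall>i. \<forall>k<rank F (Suc i). \<forall>l<rank F i. diff F i k l \<in> carrier (poly_ring X) \<and>
        (\<forall>m\<in>Poly_Mapping.keys (diff F i k l). mon_deg m + shift F i l = shift F (Suc i) k)) \<and>
     \<comment> \<open>exactness of \<open>\<dots> \<rightarrow> F\<^sub>1 \<rightarrow> F\<^sub>0 \<rightarrow> J \<rightarrow> 0\<close>\<close>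
     aug_map F ` free_mod X (rank F 0) = J \<and>
     {v \<in> free_mod X (rank F 0). aug_map F v = 0} =
       diff_map F 0 ` free_mod X (rank F (Suc 0)) \<and>
     (\<forall>i. {v \<in> free_mod X (rank F (Suc i)). diff_map F i v = (\<lambda>_. 0)} =
       diff_map F (Suc i) ` free_mod X (rank F (Suc (Suc i))))"

definition minimal_graded_free_resolution ::
    "nat set \<Rightarrow> 'k::comm_ring_1 mpoly set \<Rightarrow> 'k mpoly free_res \<Rightarrow> bool" where
  "minimal_graded_free_resolution X J F \<longleftrightarrow>
     graded_free_resolution X J F \<and>
     (\<forall>i. \<forall>k<rank F (Suc i). \<forall>l<rank F i. diff F i k l \<in> Idl\<^bsub>poly_ring X\<^esub> (Var ` X))"

text \<open>For a graded ideal \<open>J\<close> of \<open>K[x\<^sub>i : i \<in> X]\<close> with \<open>K\<close> a field and \<open>X\<close> finite, a minimal graded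
  free resolution exists and is unique up to isomorphism, so the Betti numbers
  \<open>\<beta>\<^sub>i\<^sub>j(J)\<close> may be read off from any choice.\<close>

definition graded_betti ::
    "nat set \<Rightarrow> 'k::comm_ring_1 mpoly set \<Rightarrow> nat \<Rightarrow> nat \<Rightarrow> nat" where
  "graded_betti X J i j =
     (let F = (SOME F. minimal_graded_free_resolution X J F)
      in card {k. k < rank F i \<and> shift F i k = j})"

definition reg :: "nat set \<Rightarrow> 'k::comm_ring_1 mpoly set \<Rightarrow> int" where
  "reg X J = Max {int j - int i | i j. graded_betti X J i j \<noteq> 0}"

definition linear_resolution :: "nat set \<Rightarrow> 'k::comm_ring_1 mpoly set \<Rightarrow> bool" where
  "linear_resolution X J \<longleftrightarrow>
     (\<exists>e. (\<exists>G \<subseteq> carrier (poly_ring X). (\<forall>g\<in>G. homogeneous e g) \<and> J = Idl\<^bsub>poly_ring X\<^esub> G) \<and>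
          reg X J = int e)"

end

theory Submission
  imports Defs
begin

text \<open>Let \<open>P\<close> be an associated prime of \<open>I\<close>, let \<open>A\<close> be the set of its variables, \<open>T = K[A]\<close> with graded maximal
ideal \<open>\<mm>\<close>, and \<open>J = I(P)\<close>. A monomial of \<open>T\<close> lies in \<open>J\<close> iff its degree in the variables of \<open>Q\<close> is at least
\<open>d\<^sub>Q\<close> for every associated prime \<open>Q \<subseteq> P\<close>; in particular \<open>J \<subseteq> \<mm>\<^bsup>d\<^esup>\<close> for \<open>d = d\<^sub>P\<close>. The whole theorem comes
from one monomial: \<^emph>\<open>\<open>T/J\<close> has a socle element of degree \<open>d - 1\<close>\<close>. Indeed \<open>P\<close> is the annihilator of the
class of some \<open>h\<close>, which forces \<open>h \<notin> P\<^bsup>d\<^esup>\<close> but \<open>h \<in> Q\<^bsup>d\<^sub>Q\<^esup>\<close> for every associated \<open>Q \<subset> P\<close>; a monomial of \<open>h\<close> of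
\<open>A\<close>-degree less than \<open>d\<close>, stripped of the variables outside \<open>A\<close> and multiplied by a power of a variable so
as to reach degree \<open>d - 1\<close>, is not in \<open>J\<close> but all its multiples by variables are (lemma
\<open>socle_monomial\<close>).

A socle element of degree \<open>e\<close> of \<open>T/J\<close> produces a basis element of degree \<open>e + |A|\<close> at place \<open>|A|\<close> of every
graded free resolution of \<open>T/J\<close> (theorem \<open>socle_degree\<close>). This is the usual computation of
\<open>Tor\<close> with the Koszul complex, carried out one variable at a time: if the socle element is \<open>f\<close> and
\<open>x f = \<partial>u\<close>, then \<open>u\<close> is a socle element of degree one higher for the complex obtained by dropping \<open>F\<^sub>0\<close> and
setting \<open>x = 0\<close>, and that complex is again acyclic. Hence \<open>reg J \<ge> d\<close>, which is (a).

If \<open>reg J = d\<close>, then the generators of \<open>J\<close> have degree at most \<open>d\<close> by the definition of regularity and at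
least \<open>d\<close> because \<open>J \<subseteq> \<mm>\<^bsup>d\<^esup>\<close>, so the resolution is linear. Conversely, \<open>J\<close> contains a monomial of degree
\<open>d\<close>, a variable times the socle monomial, so if \<open>J\<close> is generated in the single degree \<open>e = reg J\<close> then
\<open>e \<le> d\<close>, and equality holds by (a). The same monomial comes from an element of \<open>I\<close> with a term of \<open>A\<close>-degree
\<open>d\<close>, so \<open>I \<subseteq> P\<^bsup>r\<^esup>\<close> is possible only for \<open>r \<le> d\<close>; together with (a) and (b) this gives the last claim.

Regularity is a maximum over the Betti numbers read off from a chosen minimal resolution, so this
argument needs two classical facts for monomial ideals. A minimal graded free resolution exists
(\<open>minimal_resolution_exists\<close>): all kernels are graded by exponent vectors, and for
such submodules finite generation reduces to Dickson's lemma. It has finite length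
(\<open>minimal_acyclic_complex_length\<close>, Hilbert's syzygy theorem): the same induction on the
variables applies, because dropping \<open>F\<^sub>0\<close> and setting a variable to zero keeps the complex acyclic and minimal.\<close>

abbreviation "lookup \<equiv> Poly_Mapping.lookup"
abbreviation "keys \<equiv> Poly_Mapping.keys"
abbreviation "single \<equiv> Poly_Mapping.single"

section \<open>Parts of polynomials\<close>

definition filter_keys :: "('a \<Rightarrow> bool) \<Rightarrow> ('a \<Rightarrow>\<^sub>0 'b::zero) \<Rightarrow> ('a \<Rightarrow>\<^sub>0 'b)" where
  "filter_keys Q f = Poly_Mapping.mapp (\<lambda>k v. v when Q k) f"

lemma lookup_filter_keys: "lookup (filter_keys Q f) k = (lookup f k when Q k)"
  by (auto simp: filter_keys_def lookup_mapp when_def in_keys_iff)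

lemma keys_filter_keys [simp]: "keys (filter_keys Q f) = {k \<in> keys f. Q k}"
  by (auto simp: in_keys_iff lookup_filter_keys)

lemma filter_keys_zero [simp]: "filter_keys Q 0 = 0"
  by (rule poly_mapping_eqI) (simp add: lookup_filter_keys)

lemma filter_keys_add: "filter_keys Q (f + g) = filter_keys Q f + filter_keys Q g"
  by (rule poly_mapping_eqI) (simp add: lookup_filter_keys lookup_add when_def)

lemma filter_keys_sum: "filter_keys Q (sum f A) = (\<Sum>a\<in>A. filter_keys Q (f a))"
  by (induction A rule: infinite_finite_induct) (simp_all add: filter_keys_add)

lemma filter_keys_split: "f = filter_keys Q f + filter_keys (\<lambda>k. \<not> Q k) f"
  by (rule poly_mapping_eqI) (simp add: lookup_filter_keys lookup_add when_def)

lemma filter_keys_id: "(\<And>k. k \<in> keys f \<Longrightarrow> Q k) \<Longrightarrow> filter_keys Q f = f"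
  by (rule poly_mapping_eqI) (auto simp: lookup_filter_keys when_def in_keys_iff)

lemma filter_keys_none: "(\<And>k. k \<in> keys f \<Longrightarrow> \<not> Q k) \<Longrightarrow> filter_keys Q f = 0"
  by (rule poly_mapping_eqI) (auto simp: lookup_filter_keys when_def in_keys_iff)

lemma keys_mult_obtain:
  assumes "m \<in> keys (f * g)"
  obtains a b where "a \<in> keys f" "b \<in> keys g" "m = a + b"
  using assms keys_mult[of f g] by blast

text \<open>Taking a homogeneous part commutes with multiplication by a homogeneous factor, in the weak form
that only requires the condition on a product to be decided by its first factor. Both the
graded components of vectors and the substitution of zero for a variable are instances.\<close>
lemma filter_keys_mult:
  fixes f g :: "'a::comm_monoid_add \<Rightarrow>\<^sub>0 'b::comm_ring_1"
  assumes "\<And>a b. a \<in> keys f \<Longrightarrow> b \<in> keys g \<Longrightarrow> Q (a + b) \<longleftrightarrow> Q' a"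
  shows "filter_keys Q (f * g) = filter_keys Q' f * g"
proof -
  have "f * g = filter_keys Q' f * g + filter_keys (\<lambda>k. \<not> Q' k) f * g"
    by (metis distrib_right filter_keys_split)
  moreover have "filter_keys Q (filter_keys Q' f * g) = filter_keys Q' f * g"
    by (rule filter_keys_id) (auto elim!: keys_mult_obtain simp: assms)
  moreover have "filter_keys Q (filter_keys (\<lambda>k. \<not> Q' k) f * g) = 0"
    by (rule filter_keys_none) (auto elim!: keys_mult_obtain simp: assms)
  ultimately show ?thesis
    by (metis add_0_right filter_keys_add)
qed

lemma poly_mapping_sum_single: "f = (\<Sum>m\<in>keys f. single m (lookup f m))"
  by (rule poly_mapping_eqI)
     (auto simp: lookup_sum lookup_single when_def in_keys_iff)

lemma keys_add_nat: "keys (a + b) = keys a \<union> keys (b :: 'a \<Rightarrow>\<^sub>0 nat)"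
  by (auto simp: in_keys_iff lookup_add)

section \<open>Polynomial subrings\<close>

lemma indets_subset_iff: "indets f \<subseteq> X \<longleftrightarrow> (\<forall>m\<in>keys f. keys m \<subseteq> X)"
  by (auto simp: indets_def)

lemma poly_ring_simps [simp]:
  "f \<in> carrier (poly_ring X) \<longleftrightarrow> indets f \<subseteq> X"
  "mult (poly_ring X) = (*)" "one (poly_ring X) = 1"
  "zero (poly_ring X) = 0" "add (poly_ring X) = (+)"
  by (simp_all add: poly_ring_def)

lemma indets_zero [simp]: "indets 0 = {}"
  by (simp add: indets_def)

lemma indets_one [simp]: "indets 1 = {}"
  by (simp add: indets_def)

lemma indets_uminus [simp]: "indets (- f) = indets f"
  by (simp add: indets_def)

lemma indets_add: "indets f \<subseteq> X \<Longrightarrow> indets g \<subseteq> X \<Longrightarrow> indets (f + g) \<subseteq> X"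
  using Poly_Mapping.keys_add[of f g] unfolding indets_def by blast

lemma indets_diff: "indets f \<subseteq> X \<Longrightarrow> indets g \<subseteq> X \<Longrightarrow> indets (f - g) \<subseteq> X"
  using indets_add[of f X "- g"] by simp

lemma indets_mult: "indets f \<subseteq> X \<Longrightarrow> indets g \<subseteq> X \<Longrightarrow> indets (f * g) \<subseteq> X"
  unfolding indets_subset_iff by (fastforce elim!: keys_mult_obtain simp: keys_add_nat)

lemma indets_sum: "(\<And>a. a \<in> A \<Longrightarrow> indets (f a) \<subseteq> X) \<Longrightarrow> indets (sum f A) \<subseteq> X"
proof (induction A rule: infinite_finite_induct)
  case (insert a A)
  then show ?case by (simp add: indets_add)
qed simp_all

lemma indets_single: "keys m \<subseteq> X \<Longrightarrow> indets (single m c) \<subseteq> X"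
  by (simp add: indets_subset_iff)

lemma indets_filter_keys: "indets f \<subseteq> X \<Longrightarrow> indets (filter_keys Q f) \<subseteq> X"
  by (simp add: indets_subset_iff)

lemma keys_Var [simp]: "keys (Var i :: 'k::comm_ring_1 mpoly) = {single i 1}"
  by (simp add: Var_def)

lemma indets_Var [simp]: "indets (Var i :: 'k::comm_ring_1 mpoly) = {i}"
  by (simp add: indets_def)

lemma Var_times_single: "Var i * single m c = single (single i 1 + m) c"
  by (simp add: Var_def mult_single)

lemma indets_empty_iff: "indets f \<subseteq> {} \<longleftrightarrow> f = single 0 (lookup f 0)"
proof
  assume "indets f \<subseteq> {}"
  then have "keys m = {}" if "m \<in> keys f" for m
    using that by (auto simp: indets_def)
  then have "m = 0" if "m \<in> keys f" for m
    using that by (metis keys_eq_empty)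
  then show "f = single 0 (lookup f 0)"
    by (intro poly_mapping_eqI) (auto simp: lookup_single when_def in_keys_iff)
next
  assume "f = single 0 (lookup f 0)"
  then show "indets f \<subseteq> {}"
    by (metis indets_single keys_zero order_refl)
qed

section \<open>Monomial ideals\<close>

definition mon_ideal :: "nat set \<Rightarrow> (nat \<Rightarrow>\<^sub>0 nat) set \<Rightarrow> 'k::comm_ring_1 mpoly set" where
  "mon_ideal X U = {f. indets f \<subseteq> X \<and> keys f \<subseteq> U}"

text \<open>The order of a monomial along the prime generated by the variables in \<open>A\<close>.\<close>
definition deg_in :: "nat set \<Rightarrow> (nat \<Rightarrow>\<^sub>0 nat) \<Rightarrow> nat" where
  "deg_in A m = (\<Sum>i\<in>A. lookup m i)"

lemma deg_in_add [simp]: "deg_in A (a + b) = deg_in A a + deg_in A b"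
  by (simp add: deg_in_def lookup_add sum.distrib)

lemma deg_in_single [simp]: "finite A \<Longrightarrow> deg_in A (single i c) = (if i \<in> A then c else 0)"
  by (simp add: deg_in_def lookup_single when_def)

lemma mon_deg_eq_deg_in: "finite A \<Longrightarrow> keys m \<subseteq> A \<Longrightarrow> mon_deg m = deg_in A m"
  unfolding mon_deg_def deg_in_def by (rule sum.mono_neutral_left) (auto simp: in_keys_iff)

lemma mon_deg_add: "mon_deg (a + b) = mon_deg a + mon_deg b"
  using mon_deg_eq_deg_in[of "keys a \<union> keys b" "a + b"] mon_deg_eq_deg_in[of "keys a \<union> keys b" a]
    mon_deg_eq_deg_in[of "keys a \<union> keys b" b]
  by (simp add: keys_add_nat)

lemma mon_deg_zero [simp]: "mon_deg 0 = 0"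
  by (simp add: mon_deg_def)

lemma mon_deg_single [simp]: "mon_deg (single i c) = c"
  by (simp add: mon_deg_def)

text \<open>The closure properties of ideals of the record-based ring, in terms of the operations of
the polynomial type, so that arithmetic can be left to the simplifier.\<close>
lemma ideal_polyD:
  assumes "ideal J (poly_ring X)"
  shows "0 \<in> J" "\<And>f g. f \<in> J \<Longrightarrow> g \<in> J \<Longrightarrow> f + g \<in> J"
    "\<And>f g. indets f \<subseteq> X \<Longrightarrow> g \<in> J \<Longrightarrow> f * g \<in> J"
    "\<And>f. f \<in> J \<Longrightarrow> indets f \<subseteq> X"
  using additive_subgroup.zero_closed[OF ideal.axioms(1)[OF assms]]
    additive_subgroup.a_closed[OF ideal.axioms(1)[OF assms]]
    ideal.I_l_closed[OF assms] ideal.Icarr[OF assms] by simp_all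

lemma ideal_poly_sum:
  assumes "ideal J (poly_ring X)" "\<And>a. a \<in> A \<Longrightarrow> f a \<in> J"
  shows "sum f A \<in> J"
  using assms(2) by (induction A rule: infinite_finite_induct) (auto intro: ideal_polyD[OF assms(1)])

lemma ideal_polyI:
  fixes J :: "'k::comm_ring_1 mpoly set"
  assumes "0 \<in> J" "\<And>f g. f \<in> J \<Longrightarrow> g \<in> J \<Longrightarrow> f + g \<in> J"
    "\<And>f g. indets f \<subseteq> X \<Longrightarrow> g \<in> J \<Longrightarrow> f * g \<in> J"
    "\<And>f. f \<in> J \<Longrightarrow> indets f \<subseteq> X"
  shows "ideal J (poly_ring X)"
proof -
  interpret R: cring "poly_ring X :: 'k mpoly ring" by (rule cring_poly_ring)
  have inv: "\<ominus>\<^bsub>poly_ring X\<^esub> f = - f" if "indets f \<subseteq> X" for f :: "'k mpoly"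
    using that by (intro R.minus_equality) auto
  show ?thesis
  proof (rule idealI)
    show "ring (poly_ring X :: 'k mpoly ring)" by (rule R.ring_axioms)
    show "subgroup J (add_monoid (poly_ring X))"
    proof (rule group.subgroupI)
      show "group (add_monoid (poly_ring X :: 'k mpoly ring))"
        using R.a_group .
      show "J \<subseteq> carrier (add_monoid (poly_ring X))" using assms(4) by (auto simp: subset_iff)
      show "J \<noteq> {}" using assms(1) by auto
      fix a assume a: "a \<in> J"
      have "- a = (- 1) * a" by simp
      then have "- a \<in> J" using assms(3)[of "-1" a] a by (metis empty_subsetI indets_one indets_uminus)
      then show "inv\<^bsub>add_monoid (poly_ring X)\<^esub> a \<in> J"
        using inv[OF assms(4)[OF a]] by (simp add: a_inv_def)
    qed (use assms(2) in auto)
    fix a x assume "a \<in> J" "x \<in> carrier (poly_ring X :: 'k mpoly ring)"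
    then have "x * a \<in> J" using assms(3) by simp
    then show "x \<otimes>\<^bsub>poly_ring X\<^esub> a \<in> J" "a \<otimes>\<^bsub>poly_ring X\<^esub> x \<in> J"
      by (simp_all add: mult.commute)
  qed
qed

lemma ideal_mon_ideal:
  assumes "\<And>a m. keys a \<subseteq> X \<Longrightarrow> m \<in> U \<Longrightarrow> a + m \<in> U"
  shows "ideal (mon_ideal X U :: 'k::comm_ring_1 mpoly set) (poly_ring X)"
proof (rule ideal_polyI)
  fix f g :: "'k mpoly" assume "f \<in> mon_ideal X U" "g \<in> mon_ideal X U"
  then show "f + g \<in> mon_ideal X U"
    using Poly_Mapping.keys_add[of f g] indets_add[of f X g] by (auto simp: mon_ideal_def)
next
  fix f g :: "'k mpoly" assume "indets f \<subseteq> X" "g \<in> mon_ideal X U"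
  then have "m \<in> U" if "m \<in> keys (f * g)" for m
    using that assms by (elim keys_mult_obtain) (auto simp: mon_ideal_def indets_subset_iff)
  with \<open>indets f \<subseteq> X\<close> \<open>g \<in> mon_ideal X U\<close> show "f * g \<in> mon_ideal X U"
    using indets_mult[of f X g] by (auto simp: mon_ideal_def)
qed (auto simp: mon_ideal_def)

text \<open>A polynomial of a monomial ideal is the sum of its terms, and these lie in the ideal as well.\<close>
lemma mon_ideal_subset_ideal:
  fixes J :: "'k::comm_ring_1 mpoly set"
  assumes J: "ideal J (poly_ring X)"
    and "\<And>m c. m \<in> U \<Longrightarrow> keys m \<subseteq> X \<Longrightarrow> single m c \<in> J"
  shows "mon_ideal X U \<subseteq> J"
proof
  fix f :: "'k mpoly" assume "f \<in> mon_ideal X U"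
  then have "single m (lookup f m) \<in> J" if "m \<in> keys f" for m
    using that assms(2) by (auto simp: mon_ideal_def indets_subset_iff)
  then show "f \<in> J"
    by (subst poly_mapping_sum_single) (rule ideal_poly_sum[OF J])
qed

lemma deg_in_Suc_split:
  assumes "finite A" "Suc e \<le> deg_in A m"
  obtains a m' where "a \<in> A" "m = single a 1 + m'" "e \<le> deg_in A m'" "keys m' \<subseteq> keys m"
proof -
  have "\<exists>a\<in>A. lookup m a \<noteq> 0"
  proof (rule ccontr)
    assume "\<not> ?thesis"
    then have "deg_in A m = 0" by (simp add: deg_in_def)
    then show False using assms by simp
  qed
  then obtain a where a: "a \<in> A" "lookup m a \<noteq> 0" by blast
  have m: "m = single a 1 + (m - single a 1)"
    using a by (intro poly_mapping_eqI) (auto simp: lookup_add lookup_minus lookup_single when_def)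
  then have "deg_in A m = 1 + deg_in A (m - single a 1)"
    using a assms(1) by (metis deg_in_add deg_in_single)
  moreover have "keys (m - single a 1) \<subseteq> keys m"
    by (auto simp: in_keys_iff lookup_minus)
  ultimately show thesis using that[OF a(1) m] assms(2) by simp
qed

text \<open>By \<open>genideal_Var\<close> and \<open>ideal_pow_mon_power\<close> below this is the \<open>e\<close>-th power of the prime generated by the variables in \<open>A\<close>.\<close>
abbreviation mon_power :: "nat set \<Rightarrow> nat set \<Rightarrow> nat \<Rightarrow> 'k::comm_ring_1 mpoly set" where
  "mon_power X A e \<equiv> mon_ideal X {m. e \<le> deg_in A m}"

lemma ideal_mon_power: "ideal (mon_power X A e :: 'k::comm_ring_1 mpoly set) (poly_ring X)"
  by (rule ideal_mon_ideal) simp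

lemma Var_in_mon_power:
  assumes "finite A" "A \<subseteq> X"
  shows "Var i \<in> (mon_power X A 1 :: 'k::comm_ring_1 mpoly set) \<longleftrightarrow> i \<in> A"
  using assms by (auto simp: mon_ideal_def)

lemma genideal_Var:
  assumes "finite A" "A \<subseteq> X"
  shows "Idl\<^bsub>poly_ring X\<^esub> (Var ` A) = (mon_power X A 1 :: 'k::comm_ring_1 mpoly set)"
proof
  interpret R: cring "poly_ring X :: 'k mpoly ring" by (rule cring_poly_ring)
  show "Idl\<^bsub>poly_ring X\<^esub> (Var ` A) \<subseteq> (mon_power X A 1 :: 'k mpoly set)"
    by (rule R.genideal_minimal[OF ideal_mon_power]) (use assms Var_in_mon_power in blast)
  have sub: "Var ` A \<subseteq> carrier (poly_ring X :: 'k mpoly ring)"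
    using assms by auto
  show "mon_power X A 1 \<subseteq> (Idl\<^bsub>poly_ring X\<^esub> (Var ` A) :: 'k mpoly set)"
  proof (rule mon_ideal_subset_ideal[OF R.genideal_ideal[OF sub]])
    fix m and c :: 'k assume "m \<in> {m. 1 \<le> deg_in A m}" and m: "keys m \<subseteq> X"
    then obtain a m' where am: "a \<in> A" "m = single a 1 + m'" "keys m' \<subseteq> keys m"
      using deg_in_Suc_split[OF assms(1), of 0 m] by auto
    have "single m' c * Var a \<in> (Idl\<^bsub>poly_ring X\<^esub> (Var ` A) :: 'k mpoly set)"
    proof (rule ideal_polyD(3)[OF R.genideal_ideal[OF sub]])
      show "indets (single m' c) \<subseteq> X" using am m by (intro indets_single) auto
      show "Var a \<in> (Idl\<^bsub>poly_ring X\<^esub> (Var ` A) :: 'k mpoly set)"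
        by (rule subsetD[OF R.genideal_self[OF sub]]) (simp add: am(1))
    qed
    then show "single m c \<in> Idl\<^bsub>poly_ring X\<^esub> (Var ` A)"
      by (metis am(2) Var_times_single mult.commute)
  qed
qed

text \<open>A monomial of \<open>A\<close>-degree at least \<open>e + 1\<close> splits off a variable of \<open>A\<close>.\<close>
lemma mon_power_prod:
  assumes "finite A" "A \<subseteq> X"
  shows "ideal_prod (poly_ring X) (mon_power X A e) (mon_power X A 1)
    = (mon_power X A (Suc e) :: 'k::comm_ring_1 mpoly set)"
proof
  interpret R: cring "poly_ring X :: 'k mpoly ring" by (rule cring_poly_ring)
  show "ideal_prod (poly_ring X) (mon_power X A e) (mon_power X A 1)
    \<subseteq> (mon_power X A (Suc e) :: 'k mpoly set)"
  proof
    fix f :: "'k mpoly"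
    assume "f \<in> ideal_prod (poly_ring X) (mon_power X A e) (mon_power X A 1)"
    then show "f \<in> mon_power X A (Suc e)"
    proof induction
      case (prod f g)
      then have "keys (f * g) \<subseteq> {m. Suc e \<le> deg_in A m}"
        by (auto simp: mon_ideal_def subset_iff elim!: keys_mult_obtain) fastforce
      with prod show ?case by (auto simp: mon_ideal_def indets_mult)
    next
      case (sum f g)
      then show ?case using ideal_polyD(2)[OF ideal_mon_power] by auto
    qed
  qed
  show "mon_power X A (Suc e)
    \<subseteq> (ideal_prod (poly_ring X) (mon_power X A e) (mon_power X A 1) :: 'k mpoly set)"
  proof (rule mon_ideal_subset_ideal[OF R.ideal_prod_is_ideal[OF ideal_mon_power ideal_mon_power]])
    fix m and c :: 'k assume "m \<in> {m. Suc e \<le> deg_in A m}" and m: "keys m \<subseteq> X"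
    then obtain a m' where am: "a \<in> A" "m = single a 1 + m'" "e \<le> deg_in A m'" "keys m' \<subseteq> keys m"
      using deg_in_Suc_split[OF assms(1), of e m] by auto
    have "single m' c \<otimes>\<^bsub>poly_ring X\<^esub> Var a
      \<in> ideal_prod (poly_ring X) (mon_power X A e) (mon_power X A 1)"
    proof (rule ideal_prod.prod)
      show "single m' c \<in> mon_power X A e"
        using am m by (auto simp: mon_ideal_def intro!: indets_single)
      show "Var a \<in> (mon_power X A 1 :: 'k mpoly set)" using Var_in_mon_power[OF assms] am(1) by blast
    qed
    then show "single m c \<in> ideal_prod (poly_ring X) (mon_power X A e) (mon_power X A 1)"
      by (metis am(2) Var_times_single mult.commute poly_ring_simps(2))
  qed
qed

lemma ideal_pow_mon_power:
  assumes "finite A" "A \<subseteq> X"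
  shows "ideal_pow (poly_ring X) (mon_power X A 1) e = (mon_power X A e :: 'k::comm_ring_1 mpoly set)"
proof -
  have set_simps: "one (ideals_set R) = carrier R" "mult (ideals_set R) = ideal_prod R"
    for R :: "'k mpoly ring"
    by (simp_all add: ideals_set_def)
  show ?thesis
  proof (induction e)
    case 0
    show ?case by (auto simp: nat_pow_def set_simps mon_ideal_def)
  next
    case (Suc e)
    then show ?case
      using mon_power_prod[OF assms, of e, where 'k='k] by (simp add: nat_pow_def set_simps)
  qed
qed


section \<open>Linear maps between free modules\<close>

definition mat_map ::
    "nat \<Rightarrow> nat \<Rightarrow> (nat \<Rightarrow> nat \<Rightarrow> 'k mpoly) \<Rightarrow> (nat \<Rightarrow> 'k::comm_ring_1 mpoly) \<Rightarrow> nat \<Rightarrow> 'k mpoly" where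
  "mat_map r' r M v = (\<lambda>l. if l < r then \<Sum>k<r'. v k * M k l else 0)"

lemma diff_map_eq_mat_map: "diff_map F i = mat_map (rank F (Suc i)) (rank F i) (diff F i)"
  by (auto simp: diff_map_def mat_map_def fun_eq_iff)

lemma mat_map_zero [simp]: "mat_map r' r M (\<lambda>k. 0) = (\<lambda>l. 0)"
  by (simp add: mat_map_def fun_eq_iff)

lemma mat_map_add: "mat_map r' r M (\<lambda>k. v k + w k) = (\<lambda>l. mat_map r' r M v l + mat_map r' r M w l)"
  by (simp add: mat_map_def fun_eq_iff distrib_right sum.distrib)

lemma mat_map_diff: "mat_map r' r M (\<lambda>k. v k - w k) = (\<lambda>l. mat_map r' r M v l - mat_map r' r M w l)"
  by (simp add: mat_map_def fun_eq_iff left_diff_distrib sum_subtractf)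

lemma mat_map_scale: "mat_map r' r M (\<lambda>k. c * v k) = (\<lambda>l. c * mat_map r' r M v l)"
  by (simp add: mat_map_def fun_eq_iff sum_distrib_left mult.assoc)

lemma free_mod_iff: "v \<in> free_mod X r \<longleftrightarrow> (\<forall>k. indets (v k) \<subseteq> X) \<and> (\<forall>k\<ge>r. v k = 0)"
  by (auto simp: free_mod_def) (metis empty_iff indets_zero linorder_le_less_linear subsetD)

lemma free_mod_zero: "(\<lambda>k. 0) \<in> free_mod X r"
  by (simp add: free_mod_iff)

lemma free_mod_add: "v \<in> free_mod X r \<Longrightarrow> w \<in> free_mod X r \<Longrightarrow> (\<lambda>k. v k + w k) \<in> free_mod X r"
  by (simp add: free_mod_iff indets_add)

lemma free_mod_diff: "v \<in> free_mod X r \<Longrightarrow> w \<in> free_mod X r \<Longrightarrow> (\<lambda>k. v k - w k) \<in> free_mod X r"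
  by (simp add: free_mod_iff indets_diff)

lemma free_mod_scale: "v \<in> free_mod X r \<Longrightarrow> indets c \<subseteq> X \<Longrightarrow> (\<lambda>k. c * v k) \<in> free_mod X r"
  by (simp add: free_mod_iff indets_mult)

lemma mat_map_in_free_mod:
  assumes "\<And>k l. k < r' \<Longrightarrow> l < r \<Longrightarrow> indets (M k l) \<subseteq> X" "v \<in> free_mod X r'"
  shows "mat_map r' r M v \<in> free_mod X r"
proof -
  have "indets (\<Sum>k<r'. v k * M k l) \<subseteq> X" if "l < r" for l
    using assms that by (intro indets_sum indets_mult) (simp_all add: free_mod_iff)
  then show ?thesis by (simp add: free_mod_iff mat_map_def)
qed

section \<open>Homogeneous components\<close>

text \<open>Two gradings are in use. With \<open>dg\<close> the total degree one measures the shifts in a resolution; with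
\<open>dg\<close> the identity, degrees are exponent vectors, and finite generation of graded submodules
becomes a matter of monomials.\<close>

definition vec_comp :: "((nat \<Rightarrow>\<^sub>0 nat) \<Rightarrow> 'g::ab_semigroup_add) \<Rightarrow> (nat \<Rightarrow> 'g) \<Rightarrow> 'g
    \<Rightarrow> (nat \<Rightarrow> 'k::comm_ring_1 mpoly) \<Rightarrow> nat \<Rightarrow> 'k mpoly" where
  "vec_comp dg s e v = (\<lambda>k. filter_keys (\<lambda>m. dg m + s k = e) (v k))"

definition vec_homogeneous :: "((nat \<Rightarrow>\<^sub>0 nat) \<Rightarrow> 'g::ab_semigroup_add) \<Rightarrow> (nat \<Rightarrow> 'g) \<Rightarrow> 'g
    \<Rightarrow> (nat \<Rightarrow> 'k::comm_ring_1 mpoly) \<Rightarrow> bool" where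
  "vec_homogeneous dg s e v \<longleftrightarrow> (\<forall>k. \<forall>m\<in>keys (v k). dg m + s k = e)"

lemma vec_homogeneous_comp: "vec_homogeneous dg s e (vec_comp dg s e v)"
  by (simp add: vec_homogeneous_def vec_comp_def)

lemma vec_comp_homogeneous: "vec_homogeneous dg s e v \<Longrightarrow> vec_comp dg s e v = v"
  by (auto simp: vec_homogeneous_def vec_comp_def fun_eq_iff intro!: filter_keys_id)

lemma vec_comp_in_free_mod: "v \<in> free_mod X r \<Longrightarrow> vec_comp dg s e v \<in> free_mod X r"
  by (simp add: free_mod_iff vec_comp_def indets_filter_keys)

lemma vec_comp_zero [simp]: "vec_comp dg s e (\<lambda>k. 0) = (\<lambda>k. 0)"
  by (simp add: vec_comp_def)

text \<open>A matrix with homogeneous entries is a map of degree zero. Hence preimages of homogeneous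
elements can be chosen homogeneous, and kernels are graded.\<close>
lemma vec_comp_mat_map:
  fixes dg :: "(nat \<Rightarrow>\<^sub>0 nat) \<Rightarrow> 'g::ab_semigroup_add"
  assumes dg: "\<And>a b. dg (a + b) = dg a + dg b"
    and M: "\<And>k l m. k < r' \<Longrightarrow> l < r \<Longrightarrow> m \<in> keys (M k l) \<Longrightarrow> dg m + s l = s' k"
  shows "vec_comp dg s e (mat_map r' r M v) = mat_map r' r M (vec_comp dg s' e v)"
proof
  fix l
  have "filter_keys (\<lambda>m. dg m + s l = e) (v k * M k l)
      = filter_keys (\<lambda>m. dg m + s' k = e) (v k) * M k l" if "k < r'" "l < r" for k
    by (rule filter_keys_mult) (simp add: dg add.assoc M[OF that])
  then show "vec_comp dg s e (mat_map r' r M v) l = mat_map r' r M (vec_comp dg s' e v) l"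
    by (simp add: vec_comp_def mat_map_def filter_keys_sum)
qed

section \<open>Setting a variable to zero\<close>

definition at_zero :: "nat \<Rightarrow> 'k::comm_ring_1 mpoly \<Rightarrow> 'k mpoly" where
  "at_zero x f = filter_keys (\<lambda>m. lookup m x = 0) f"

lemma at_zero_zero [simp]: "at_zero x 0 = 0"
  by (simp add: at_zero_def)

lemma at_zero_add: "at_zero x (f + g) = at_zero x f + at_zero x g"
  by (simp add: at_zero_def filter_keys_add)

lemma at_zero_sum: "at_zero x (sum f A) = (\<Sum>a\<in>A. at_zero x (f a))"
  by (simp add: at_zero_def filter_keys_sum)

lemma at_zero_id: "indets f \<subseteq> X \<Longrightarrow> x \<notin> X \<Longrightarrow> at_zero x f = f"
  unfolding at_zero_def
  by (rule filter_keys_id) (metis indets_subset_iff not_in_keys_iff_lookup_eq_zero subsetD)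

lemma indets_at_zero: "indets f \<subseteq> insert x X \<Longrightarrow> indets (at_zero x f) \<subseteq> X"
  by (auto simp: indets_subset_iff at_zero_def)

lemma at_zero_mult: "at_zero x (f * g) = at_zero x f * at_zero x g"
proof -
  let ?Q = "\<lambda>m :: nat \<Rightarrow>\<^sub>0 nat. lookup m x = 0"
  have "f * g = at_zero x f * g + filter_keys (\<lambda>m. \<not> ?Q m) f * g"
    unfolding at_zero_def by (metis distrib_right filter_keys_split)
  moreover have "at_zero x (at_zero x f * g) = at_zero x f * at_zero x g"
    using filter_keys_mult[of g "at_zero x f" ?Q ?Q]
    by (simp add: mult.commute at_zero_def lookup_add)
  moreover have "at_zero x (filter_keys (\<lambda>m. \<not> ?Q m) f * g) = 0"
    unfolding at_zero_def
    by (rule filter_keys_none) (auto elim!: keys_mult_obtain simp: lookup_add)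
  ultimately show ?thesis by (simp add: at_zero_add)
qed

lemma at_zero_Var: "at_zero x (Var y) = (if y = x then 0 else Var y)"
  by (auto simp: at_zero_def lookup_single intro!: filter_keys_none filter_keys_id)

lemma Var_nonzero [simp]: "(Var x :: 'k::comm_ring_1 mpoly) \<noteq> 0"
  by (metis keys_Var keys_zero insert_not_empty)

text \<open>The kernel of the substitution is generated by the variable.\<close>
lemma at_zero_eq_zeroD:
  assumes "at_zero x f = 0" "indets f \<subseteq> X"
  shows "\<exists>g. f = Var x * g \<and> indets g \<subseteq> X"
proof -
  define g where "g = (\<Sum>m\<in>keys f. single (m - single x 1) (lookup f m))"
  have "single x 1 + (m - single x 1) = m" if "m \<in> keys f" for m
  proof -
    have "keys (at_zero x f) = {}" using assms by simp
    then have "lookup m x \<noteq> 0" using that by (auto simp: at_zero_def)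
    then show ?thesis
      by (intro poly_mapping_eqI) (auto simp: lookup_add lookup_minus lookup_single when_def)
  qed
  then have "Var x * g = (\<Sum>m\<in>keys f. single m (lookup f m))"
    by (simp add: g_def sum_distrib_left Var_times_single)
  moreover have "indets g \<subseteq> X"
    unfolding g_def
  proof (intro indets_sum indets_single)
    fix m assume "m \<in> keys f"
    moreover have "keys (m - single x 1) \<subseteq> keys m" by (auto simp: in_keys_iff lookup_minus)
    ultimately show "keys (m - single x 1) \<subseteq> X" using assms(2) by (auto simp: indets_subset_iff)
  qed
  ultimately show ?thesis using poly_mapping_sum_single by metis
qed

lemma vec_at_zero_eq_zeroD:
  assumes "\<And>k. at_zero x (v k) = 0" "v \<in> free_mod X r"
  shows "\<exists>w\<in>free_mod X r. v = (\<lambda>k. Var x * w k)"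
proof -
  have "\<forall>k. \<exists>g. v k = Var x * g \<and> indets g \<subseteq> X \<and> (k \<ge> r \<longrightarrow> g = 0)"
  proof
    fix k
    show "\<exists>g. v k = Var x * g \<and> indets g \<subseteq> X \<and> (k \<ge> r \<longrightarrow> g = 0)"
      using at_zero_eq_zeroD[OF assms(1), of k X] assms(2)
      by (cases "k < r") (auto simp: free_mod_iff intro!: exI[of _ 0])
  qed
  then obtain w where "\<forall>k. v k = Var x * w k \<and> indets (w k) \<subseteq> X \<and> (k \<ge> r \<longrightarrow> w k = 0)"
    by metis
  then show ?thesis by (intro bexI[of _ w]) (auto simp: free_mod_iff)
qed

lemma at_zero_vec_in_free_mod:
  "v \<in> free_mod (insert x X) r \<Longrightarrow> (\<lambda>k. at_zero x (v k)) \<in> free_mod X r"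
  by (simp add: free_mod_iff indets_at_zero)

lemma at_zero_vec_id: "v \<in> free_mod X r \<Longrightarrow> x \<notin> X \<Longrightarrow> (\<lambda>k. at_zero x (v k)) = v"
  by (auto simp: free_mod_iff fun_eq_iff intro!: at_zero_id[of _ X])

lemma free_mod_mono: "v \<in> free_mod X r \<Longrightarrow> X \<subseteq> Y \<Longrightarrow> v \<in> free_mod Y r"
  by (auto simp: free_mod_iff)

section \<open>Acyclic complexes\<close>

text \<open>Exactness is demanded at \<open>F\<^sub>1, F\<^sub>2, \<dots>\<close> only. Nothing is said about the cokernel of \<open>F\<^sub>1 \<rightarrow> F\<^sub>0\<close>, and
this is what makes the notion stable under the reduction below.\<close>
definition acyclic_complex :: "nat set \<Rightarrow> 'k::comm_ring_1 mpoly free_res \<Rightarrow> bool" where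
  "acyclic_complex X F \<longleftrightarrow>
     (\<forall>i. \<forall>k<rank F (Suc i). \<forall>l<rank F i. indets (diff F i k l) \<subseteq> X) \<and>
     (\<forall>i. {v \<in> free_mod X (rank F (Suc i)). diff_map F i v = (\<lambda>_. 0)} =
       diff_map F (Suc i) ` free_mod X (rank F (Suc (Suc i))))"

definition graded_entries :: "'k::comm_ring_1 mpoly free_res \<Rightarrow> bool" where
  "graded_entries F \<longleftrightarrow> (\<forall>i. \<forall>k<rank F (Suc i). \<forall>l<rank F i.
     \<forall>m\<in>keys (diff F i k l). mon_deg m + shift F i l = shift F (Suc i) k)"

definition minimal_entries :: "'k::comm_ring_1 mpoly free_res \<Rightarrow> bool" where
  "minimal_entries F \<longleftrightarrow>
    (\<forall>i. \<forall>k<rank F (Suc i). \<forall>l<rank F i. lookup (diff F i k l) 0 = 0)"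

text \<open>The complex \<open>\<dots> \<rightarrow> F\<^sub>2/xF\<^sub>2 \<rightarrow> F\<^sub>1/xF\<^sub>1\<close>. The module \<open>F\<^sub>0\<close> has to be dropped since \<open>x\<close> may be a zero divisor on the
cokernel of \<open>F\<^sub>1 \<rightarrow> F\<^sub>0\<close>, whereas it is regular on the image, a submodule of a free module.\<close>
definition reduced_tail :: "nat \<Rightarrow> 'k::comm_ring_1 mpoly free_res \<Rightarrow> 'k mpoly free_res" where
  "reduced_tail x F = \<lparr>rank = (\<lambda>i. rank F (Suc i)), shift = (\<lambda>i. shift F (Suc i)),
     diff = (\<lambda>i k l. at_zero x (diff F (Suc i) k l)), aug = aug F\<rparr>"

lemma reduced_tail_simps [simp]:
  "rank (reduced_tail x F) i = rank F (Suc i)"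
  "shift (reduced_tail x F) i = shift F (Suc i)"
  "diff (reduced_tail x F) i k l = at_zero x (diff F (Suc i) k l)"
  by (simp_all add: reduced_tail_def)

lemma diff_map_reduced_tail:
  "diff_map (reduced_tail x F) i (\<lambda>k. at_zero x (v k)) = (\<lambda>l. at_zero x (diff_map F (Suc i) v l))"
  by (simp add: diff_map_def fun_eq_iff at_zero_sum at_zero_mult)

lemma diff_map_in_free_mod:
  assumes "acyclic_complex X F" "v \<in> free_mod X (rank F (Suc i))"
  shows "diff_map F i v \<in> free_mod X (rank F i)"
  unfolding diff_map_eq_mat_map
  by (rule mat_map_in_free_mod) (use assms in \<open>auto simp: acyclic_complex_def\<close>)

lemma acyclic_complexD:
  "acyclic_complex X F \<Longrightarrow> {v \<in> free_mod X (rank F (Suc i)). diff_map F i v = (\<lambda>_. 0)} =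
       diff_map F (Suc i) ` free_mod X (rank F (Suc (Suc i)))"
  by (simp add: acyclic_complex_def)

lemma acyclic_complex_cycle:
  assumes "acyclic_complex X F" "v \<in> free_mod X (rank F (Suc i))" "diff_map F i v = (\<lambda>_. 0)"
  shows "\<exists>w\<in>free_mod X (rank F (Suc (Suc i))). v = diff_map F (Suc i) w"
proof -
  have "v \<in> {v \<in> free_mod X (rank F (Suc i)). diff_map F i v = (\<lambda>_. 0)}"
    using assms by simp
  then show ?thesis unfolding acyclic_complexD[OF assms(1)] by blast
qed

lemma acyclic_complex_boundary:
  assumes "acyclic_complex X F" "w \<in> free_mod X (rank F (Suc (Suc i)))"
  shows "diff_map F i (diff_map F (Suc i) w) = (\<lambda>_. 0)"
proof -
  have "diff_map F (Suc i) w \<in> {v \<in> free_mod X (rank F (Suc i)). diff_map F i v = (\<lambda>_. 0)}"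
    unfolding acyclic_complexD[OF assms(1)] using assms(2) by (rule imageI)
  then show ?thesis by simp
qed

lemma diff_map_linear:
  "diff_map F i (\<lambda>k. v k - w k) = (\<lambda>l. diff_map F i v l - diff_map F i w l)"
  "diff_map F i (\<lambda>k. c * v k) = (\<lambda>l. c * diff_map F i v l)"
  by (simp_all add: diff_map_eq_mat_map mat_map_diff mat_map_scale)

text \<open>If \<open>\<partial>v = x w\<close> then \<open>x \<partial>w = 0\<close>, so \<open>\<partial>w = 0\<close> because polynomial rings over a field are domains. Thus
\<open>w = \<partial>u\<close>, and \<open>v - x u\<close> is a cycle that agrees with \<open>v\<close> modulo \<open>x\<close>.\<close>
lemma acyclic_reduced_tail:
  fixes F :: "'k::field mpoly free_res"
  assumes F: "acyclic_complex (insert x X) F" and x: "x \<notin> X"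
  shows "acyclic_complex X (reduced_tail x F)"
proof -
  let ?G = "reduced_tail x F"
  have entries: "indets (diff ?G i k l) \<subseteq> X" if "k < rank ?G (Suc i)" "l < rank ?G i" for i k l
    using F that unfolding reduced_tail_simps
    by (intro indets_at_zero) (simp add: acyclic_complex_def)
  have cycle_iff: "v \<in> {v \<in> free_mod X (rank ?G (Suc i)). diff_map ?G i v = (\<lambda>_. 0)} \<longleftrightarrow>
    v \<in> diff_map ?G (Suc i) ` free_mod X (rank ?G (Suc (Suc i)))" for i v
  proof
    assume "v \<in> diff_map ?G (Suc i) ` free_mod X (rank ?G (Suc (Suc i)))"
    then obtain w where w: "w \<in> free_mod X (rank F (Suc (Suc (Suc i))))" "v = diff_map ?G (Suc i) w"
      by auto
    have wX: "w \<in> free_mod (insert x X) (rank F (Suc (Suc (Suc i))))"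
      using w(1) by (rule free_mod_mono) auto
    have v: "v = (\<lambda>l. at_zero x (diff_map F (Suc (Suc i)) w l))"
      using w diff_map_reduced_tail[of x F "Suc i" w] at_zero_vec_id[OF w(1) x] by simp
    have "v \<in> free_mod X (rank F (Suc (Suc i)))"
      unfolding v by (intro at_zero_vec_in_free_mod diff_map_in_free_mod[OF F] wX)
    moreover have "diff_map ?G i v = (\<lambda>_. 0)"
      unfolding v diff_map_reduced_tail acyclic_complex_boundary[OF F wX] by simp
    ultimately show "v \<in> {v \<in> free_mod X (rank ?G (Suc i)). diff_map ?G i v = (\<lambda>_. 0)}" by simp
  next
    assume "v \<in> {v \<in> free_mod X (rank ?G (Suc i)). diff_map ?G i v = (\<lambda>_. 0)}"
    then have v: "v \<in> free_mod X (rank F (Suc (Suc i)))" and dv: "diff_map ?G i v = (\<lambda>_. 0)"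
      by auto
    have vX: "v \<in> free_mod (insert x X) (rank F (Suc (Suc i)))"
      using v by (rule free_mod_mono) auto
    have "at_zero x (diff_map F (Suc i) v l) = 0" for l
      using dv diff_map_reduced_tail[of x F i v] at_zero_vec_id[OF v x] by (simp add: fun_eq_iff)
    from vec_at_zero_eq_zeroD[OF this diff_map_in_free_mod[OF F vX]]
    obtain w where w: "w \<in> free_mod (insert x X) (rank F (Suc i))"
      "diff_map F (Suc i) v = (\<lambda>k. Var x * w k)" by auto
    have "(\<lambda>k. Var x * diff_map F i w k) = (\<lambda>_. 0)"
      using acyclic_complex_boundary[OF F vX] unfolding w(2) diff_map_linear .
    then have "diff_map F i w = (\<lambda>_. 0)"
      by (auto simp: fun_eq_iff)
    then obtain u where u: "u \<in> free_mod (insert x X) (rank F (Suc (Suc i)))" "w = diff_map F (Suc i) u"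
      using acyclic_complex_cycle[OF F w(1)] by auto
    have xu: "(\<lambda>k. Var x * u k) \<in> free_mod (insert x X) (rank F (Suc (Suc i)))"
      using u(1) by (rule free_mod_scale) simp
    have "diff_map F (Suc i) (\<lambda>k. v k - Var x * u k) = (\<lambda>_. 0)"
      unfolding diff_map_linear w(2) u(2) by simp
    from acyclic_complex_cycle[OF F free_mod_diff[OF vX xu] this]
    obtain t where t: "t \<in> free_mod (insert x X) (rank F (Suc (Suc (Suc i))))"
      "(\<lambda>k. v k - Var x * u k) = diff_map F (Suc (Suc i)) t" by auto
    have "v k = at_zero x (diff_map F (Suc (Suc i)) t k)" for k
    proof -
      have "v k = diff_map F (Suc (Suc i)) t k + Var x * u k"
        using fun_cong[OF t(2), of k] by (simp add: algebra_simps)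
      then have "at_zero x (v k) = at_zero x (diff_map F (Suc (Suc i)) t k)"
        by (simp add: at_zero_add at_zero_mult at_zero_Var)
      then show ?thesis using at_zero_vec_id[OF v x] by metis
    qed
    then have "v = diff_map ?G (Suc i) (\<lambda>k. at_zero x (t k))"
      unfolding diff_map_reduced_tail by auto
    then show "v \<in> diff_map ?G (Suc i) ` free_mod X (rank ?G (Suc (Suc i)))"
      using at_zero_vec_in_free_mod[OF t(1)] by auto
  qed
  show ?thesis unfolding acyclic_complex_def
  proof (intro conjI allI impI)
    show "{v \<in> free_mod X (rank ?G (Suc i)). diff_map ?G i v = (\<lambda>_. 0)} =
        diff_map ?G (Suc i) ` free_mod X (rank ?G (Suc (Suc i)))" for i
      by (rule Set.set_eqI) (rule cycle_iff)
  qed (rule entries)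
qed

text \<open>Hilbert's syzygy theorem. The reduction lowers both the number of variables and the position by one.
Without variables, minimal entries are zero, and an acyclic complex with zero maps vanishes
from \<open>F\<^sub>1\<close> on.\<close>
theorem minimal_acyclic_complex_length:
  fixes F :: "'k::field mpoly free_res"
  assumes "finite X" "acyclic_complex X F" "minimal_entries F" "card X < i"
  shows "rank F i = 0"
  using assms
proof (induction X arbitrary: F i)
  case empty
  then obtain j where i: "i = Suc j" by (auto dest: less_imp_Suc_add)
  show ?case
  proof (rule ccontr)
    assume r: "rank F i \<noteq> 0"
    have "diff F i k l = 0" if "k < rank F (Suc i)" "l < rank F i" for k l i
    proof -
      have "indets (diff F i k l) \<subseteq> {}"
        using empty.prems(1) that by (auto simp: acyclic_complex_def)
      moreover have "lookup (diff F i k l) 0 = 0"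
        using empty.prems(2) that by (auto simp: minimal_entries_def)
      ultimately show ?thesis by (metis indets_empty_iff single_zero)
    qed
    then have 0: "diff_map F i v = (\<lambda>_. 0)" for v i
      by (auto simp: diff_map_def fun_eq_iff)
    define v :: "nat \<Rightarrow> 'k mpoly" where "v = (\<lambda>k. if k = 0 then 1 else 0)"
    have "v \<in> free_mod {} (rank F (Suc j))"
      using r i by (auto simp: v_def free_mod_iff)
    from acyclic_complex_cycle[OF empty.prems(1) this 0] have "v = (\<lambda>_. 0)"
      using 0 by auto
    then have "v 0 = 0" by simp
    then show False by (simp add: v_def)
  qed
next
  case (insert x X)
  then obtain j where i: "i = Suc j" "card X < j" by (auto dest: less_imp_Suc_add)
  have "minimal_entries (reduced_tail x F)"
    using insert.prems(2) by (simp add: minimal_entries_def at_zero_def lookup_filter_keys)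
  with insert.IH[OF acyclic_reduced_tail[OF insert.prems(1) insert.hyps(2)] _ i(2)] i(1)
  show ?case by simp
qed

text \<open>Here \<open>f\<close> represents a socle element of degree \<open>e\<close> of the cokernel of \<open>F\<^sub>1 \<rightarrow> F\<^sub>0\<close>. If \<open>x f = \<partial>u\<close>, then the
class of \<open>u\<close> modulo \<open>x\<close> is a socle element of degree \<open>e + 1\<close> for the reduced tail: from \<open>u = \<partial>t + x w\<close> one
would get \<open>x f = x \<partial>w\<close>, hence \<open>f = \<partial>w\<close>; and if \<open>y f = \<partial>w\<close>, then \<open>y u - x w\<close> is a cycle, hence a boundary, so \<open>y u\<close> is
a boundary modulo \<open>x\<close>. When no variables are left, a nonzero homogeneous vector of degree \<open>e\<close> over the
field has a nonzero coordinate at some basis element of degree \<open>e\<close>.\<close>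
theorem socle_degree:
  fixes F :: "'k::field mpoly free_res"
  assumes "finite X" "acyclic_complex X F" "graded_entries F"
    and "f \<in> free_mod X (rank F 0)" "vec_homogeneous mon_deg (shift F 0) e f"
    and "f \<notin> diff_map F 0 ` free_mod X (rank F 1)"
    and "\<And>x. x \<in> X \<Longrightarrow> (\<lambda>k. Var x * f k) \<in> diff_map F 0 ` free_mod X (rank F 1)"
  shows "\<exists>k<rank F (card X). shift F (card X) k = e + card X"
  using assms
proof (induction X arbitrary: F f e)
  case empty
  have "f \<noteq> (\<lambda>_. 0)"
  proof
    assume "f = (\<lambda>_. 0)"
    then have "f = diff_map F 0 (\<lambda>_. 0)" by (simp add: diff_map_eq_mat_map)
    then show False using empty.prems(5) free_mod_zero by blast
  qed
  then obtain k where k: "f k \<noteq> 0" by auto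
  then have "k < rank F 0" using empty.prems(3) by (metis free_mod_iff linorder_le_less_linear)
  moreover have "f k = single 0 (lookup (f k) 0)"
    using empty.prems(3) by (subst indets_empty_iff[symmetric]) (auto simp: free_mod_iff)
  then have "0 \<in> keys (f k)" using k by (metis in_keys_iff single_zero)
  then have "shift F 0 k = e"
    using empty.prems(4) unfolding vec_homogeneous_def by (metis add_0 mon_deg_zero)
  ultimately show ?case by auto
next
  case (insert x X)
  let ?X = "insert x X" and ?G = "reduced_tail x F"
  note F = insert.prems(1)
  from insert.prems(6)[of x] obtain u0 where u0: "u0 \<in> free_mod ?X (rank F 1)"
    "(\<lambda>k. Var x * f k) = diff_map F 0 u0" by auto
  \<comment> \<open>the differential has degree zero, so the component of degree \<open>e + 1\<close> is a preimage, too\<close>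
  define u where "u = vec_comp mon_deg (shift F 1) (Suc e) u0"
  have u: "u \<in> free_mod ?X (rank F (Suc 0))"
    using u0(1) by (simp add: u_def vec_comp_in_free_mod)
  have hom_xf: "vec_homogeneous mon_deg (shift F 0) (Suc e) (\<lambda>k. Var x * f k)"
    unfolding vec_homogeneous_def
  proof (intro allI ballI)
    fix k m assume "m \<in> keys (Var x * f k)"
    then obtain b where "b \<in> keys (f k)" "m = single x 1 + b" by (auto elim: keys_mult_obtain)
    then show "mon_deg m + shift F 0 k = Suc e"
      using insert.prems(4) by (auto simp: vec_homogeneous_def mon_deg_add)
  qed
  have "diff_map F 0 u = vec_comp mon_deg (shift F 0) (Suc e) (diff_map F 0 u0)"
    unfolding diff_map_eq_mat_map u_def One_nat_def
    by (rule vec_comp_mat_map[symmetric])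
       (use insert.prems(2) in \<open>auto simp: graded_entries_def mon_deg_add\<close>)
  also have "\<dots> = (\<lambda>k. Var x * f k)"
    using vec_comp_homogeneous[OF hom_xf] u0(2) by simp
  finally have du: "diff_map F 0 u = (\<lambda>k. Var x * f k)" .
  let ?u = "\<lambda>k. at_zero x (u k)"
  have "\<exists>k<rank ?G (card X). shift ?G (card X) k = Suc e + card X"
  proof (rule insert.IH)
    show "acyclic_complex X ?G" by (rule acyclic_reduced_tail[OF F insert.hyps(2)])
    show "graded_entries ?G" using insert.prems(2) by (auto simp: graded_entries_def at_zero_def)
    show "?u \<in> free_mod X (rank ?G 0)" using at_zero_vec_in_free_mod[OF u] by simp
    show "vec_homogeneous mon_deg (shift ?G 0) (Suc e) ?u"
      using vec_homogeneous_comp[of mon_deg "shift F 1" "Suc e" u0]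
      by (auto simp: vec_homogeneous_def u_def at_zero_def)
    show "?u \<notin> diff_map ?G 0 ` free_mod X (rank ?G 1)"
    proof
      assume "?u \<in> diff_map ?G 0 ` free_mod X (rank ?G 1)"
      then obtain t where t: "t \<in> free_mod X (rank F (Suc (Suc 0)))" "?u = diff_map ?G 0 t" by auto
      have tX: "t \<in> free_mod ?X (rank F (Suc (Suc 0)))" using t(1) by (rule free_mod_mono) auto
      have dt: "diff_map F (Suc 0) t \<in> free_mod ?X (rank F (Suc 0))"
        by (rule diff_map_in_free_mod[OF F tX])
      have "?u = (\<lambda>l. at_zero x (diff_map F (Suc 0) t l))"
        using t(2) diff_map_reduced_tail[of x F 0 t] at_zero_vec_id[OF t(1) insert.hyps(2)] by simp
      then have "at_zero x (u k - diff_map F (Suc 0) t k) = 0" for k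
        using at_zero_add[of x "u k - diff_map F (Suc 0) t k" "diff_map F (Suc 0) t k"]
        by (simp add: fun_eq_iff)
      from vec_at_zero_eq_zeroD[OF this free_mod_diff[OF u dt]]
      obtain w where w: "w \<in> free_mod ?X (rank F (Suc 0))"
        "(\<lambda>k. u k - diff_map F (Suc 0) t k) = (\<lambda>k. Var x * w k)" by auto
      have "diff_map F 0 (\<lambda>k. u k - diff_map F (Suc 0) t k) = (\<lambda>k. Var x * f k)"
        unfolding diff_map_linear du acyclic_complex_boundary[OF F tX] by simp
      then have "(\<lambda>k. Var x * f k) = (\<lambda>k. Var x * diff_map F 0 w k)"
        unfolding w(2) diff_map_linear by simp
      then have "f = diff_map F 0 w" by (auto simp: fun_eq_iff)
      then show False using insert.prems(5) w(1) by auto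
    qed
    show "(\<lambda>k. Var y * ?u k) \<in> diff_map ?G 0 ` free_mod X (rank ?G 1)" if y: "y \<in> X" for y
    proof -
      obtain w where w: "w \<in> free_mod ?X (rank F (Suc 0))" "(\<lambda>k. Var y * f k) = diff_map F 0 w"
        using insert.prems(6)[of y] y by auto
      have yx: "y \<noteq> x" using y insert.hyps(2) by auto
      let ?z = "\<lambda>k. Var y * u k - Var x * w k"
      have z: "?z \<in> free_mod ?X (rank F (Suc 0))"
        using y by (intro free_mod_diff free_mod_scale u w(1)) auto
      have "diff_map F 0 ?z = (\<lambda>_. 0)"
        unfolding diff_map_linear du w(2)[symmetric] by (simp add: mult.left_commute)
      from acyclic_complex_cycle[OF F z this]
      obtain t where t: "t \<in> free_mod ?X (rank F (Suc (Suc 0)))" "?z = diff_map F (Suc 0) t" by auto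
      have "Var y * ?u k = at_zero x (diff_map F (Suc 0) t k)" for k
      proof -
        have "Var y * u k = diff_map F (Suc 0) t k + Var x * w k"
          using fun_cong[OF t(2), of k] by (simp add: algebra_simps)
        then have "at_zero x (Var y * u k) = at_zero x (diff_map F (Suc 0) t k + Var x * w k)" by simp
        then show ?thesis using yx by (simp add: at_zero_add at_zero_mult at_zero_Var)
      qed
      then have "(\<lambda>k. Var y * ?u k) = diff_map ?G 0 (\<lambda>k. at_zero x (t k))"
        unfolding diff_map_reduced_tail by auto
      then show ?thesis using at_zero_vec_in_free_mod[OF t(1)] by auto
    qed
  qed
  then show ?case using insert.hyps by simp
qed


section \<open>Multigraded submodules of free modules are finitely generated\<close>

text \<open>For one more variable \<open>x\<close>, take a finite set \<open>M\<close> that works for the other variables and let \<open>b\<close> bound its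
\<open>x\<close>-exponents. An element whose \<open>x\<close>-exponent is at least \<open>b\<close> is dominated by an element of \<open>M\<close>, and there
are only finitely many slices with smaller \<open>x\<close>-exponent, each treated by induction.\<close>
lemma dickson:
  fixes L :: "(nat \<Rightarrow>\<^sub>0 nat) set"
  assumes "finite X"
  shows "\<exists>M\<subseteq>L. finite M \<and> (\<forall>m\<in>L. \<exists>m0\<in>M. \<forall>i\<in>X. lookup m0 i \<le> lookup m i)"
  using assms
proof (induction X arbitrary: L)
  case empty
  show ?case
  proof (cases "L = {}")
    case False
    then obtain m where "m \<in> L" by blast
    then show ?thesis by (intro exI[of _ "{m}"]) auto
  qed auto
next
  case (insert x X)
  obtain M where M: "M \<subseteq> L" "finite M" "\<forall>m\<in>L. \<exists>m0\<in>M. \<forall>i\<in>X. lookup m0 i \<le> lookup m i"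
    using insert.IH[of L] by blast
  define b where "b = (\<Sum>m\<in>M. lookup m x)"
  have b: "lookup m x \<le> b" if "m \<in> M" for m
    unfolding b_def using M(2) that by (rule member_le_sum[rotated 2]) simp_all
  have "\<forall>c. \<exists>M'\<subseteq>{m \<in> L. lookup m x = c}. finite M' \<and>
      (\<forall>m\<in>{m \<in> L. lookup m x = c}. \<exists>m0\<in>M'. \<forall>i\<in>X. lookup m0 i \<le> lookup m i)"
    using insert.IH by blast
  from choice[OF this] obtain Mc where "\<forall>c. Mc c \<subseteq> {m \<in> L. lookup m x = c} \<and> finite (Mc c) \<and>
      (\<forall>m\<in>{m \<in> L. lookup m x = c}. \<exists>m0\<in>Mc c. \<forall>i\<in>X. lookup m0 i \<le> lookup m i)"
    by blast
  then have Mc: "\<And>c. Mc c \<subseteq> {m \<in> L. lookup m x = c}" "\<And>c. finite (Mc c)"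
      "\<And>c m. m \<in> L \<Longrightarrow> lookup m x = c \<Longrightarrow> \<exists>m0\<in>Mc c. \<forall>i\<in>X. lookup m0 i \<le> lookup m i"
    by auto
  show ?case
  proof (intro exI[of _ "M \<union> (\<Union>c<b. Mc c)"] conjI ballI)
    show "M \<union> (\<Union>c<b. Mc c) \<subseteq> L" using M(1) Mc(1) by blast
    show "finite (M \<union> (\<Union>c<b. Mc c))" using M(2) Mc(2) by simp
    fix m assume m: "m \<in> L"
    show "\<exists>m0\<in>M \<union> (\<Union>c<b. Mc c). \<forall>i\<in>insert x X. lookup m0 i \<le> lookup m i"
    proof (cases "lookup m x < b")
      case True
      obtain m0 where m0: "m0 \<in> Mc (lookup m x)" "\<forall>i\<in>X. lookup m0 i \<le> lookup m i"
        using Mc(3)[OF m refl] by blast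
      then have "lookup m0 x = lookup m x" using Mc(1) by blast
      then show ?thesis using True m0 by (intro bexI[of _ m0]) auto
    next
      case False
      obtain m0 where m0: "m0 \<in> M" "\<forall>i\<in>X. lookup m0 i \<le> lookup m i"
        using M(3) m by blast
      then show ?thesis using False b[OF m0(1)] by (intro bexI[of _ m0]) auto
    qed
  qed
qed

inductive_set module_span :: "nat set \<Rightarrow> (nat \<Rightarrow> 'k::comm_ring_1 mpoly) set \<Rightarrow> (nat \<Rightarrow> 'k mpoly) set"
  for X G where
  zero: "(\<lambda>k. 0) \<in> module_span X G"
| step: "g \<in> G \<Longrightarrow> indets c \<subseteq> X \<Longrightarrow> w \<in> module_span X G
    \<Longrightarrow> (\<lambda>k. c * g k + w k) \<in> module_span X G"

lemma module_span_add:
  assumes "v \<in> module_span X G" "w \<in> module_span X G"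
  shows "(\<lambda>k. v k + w k) \<in> module_span X G"
  using assms(1)
proof induction
  case (step g c u)
  from module_span.step[OF step.hyps(1,2) step.IH]
  show ?case by (simp add: add.assoc)
qed (use assms(2) in simp)

lemma module_span_scale:
  assumes "v \<in> module_span X G" "indets a \<subseteq> X"
  shows "(\<lambda>k. a * v k) \<in> module_span X G"
  using assms(1)
proof induction
  case zero
  then show ?case using module_span.zero by simp
next
  case (step g c u)
  from module_span.step[OF step.hyps(1) indets_mult[OF assms(2) step.hyps(2)] step.IH]
  show ?case by (simp add: algebra_simps)
qed

lemma module_span_base:
  assumes "g \<in> G"
  shows "g \<in> module_span X G"
  using module_span.step[OF assms _ module_span.zero, of 1 X] by simp

lemma module_span_least:
  assumes "G \<subseteq> N" "(\<lambda>k. 0) \<in> N"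
    "\<And>v w. v \<in> N \<Longrightarrow> w \<in> N \<Longrightarrow> (\<lambda>k. v k + w k) \<in> N"
    "\<And>c v. indets c \<subseteq> X \<Longrightarrow> v \<in> N \<Longrightarrow> (\<lambda>k. c * v k) \<in> N"
  shows "module_span X G \<subseteq> N"
proof
  fix v assume "v \<in> module_span X G"
  then show "v \<in> N"
  proof induction
    case (step g c w)
    then show ?case using assms(1) by (intro assms(3,4)) auto
  qed (rule assms(2))
qed

lemma module_span_trans: "H \<subseteq> module_span X G \<Longrightarrow> module_span X H \<subseteq> module_span X G"
  by (rule module_span_least) (auto intro: module_span.zero module_span_add module_span_scale)

lemma module_span_mono: "H \<subseteq> G \<Longrightarrow> module_span X H \<subseteq> module_span X G"
  by (rule module_span_trans) (auto intro: module_span_base)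

lemma module_span_sum:
  assumes "\<And>a. a \<in> A \<Longrightarrow> u a \<in> module_span X G" "\<And>a. a \<in> A \<Longrightarrow> indets (c a) \<subseteq> X"
  shows "(\<lambda>k. \<Sum>a\<in>A. c a * u a k) \<in> module_span X G"
  using assms
proof (induction A rule: infinite_finite_induct)
  case (insert a A)
  have "(\<lambda>k. c a * u a k + (\<Sum>a\<in>A. c a * u a k)) \<in> module_span X G"
    by (rule module_span_add) (use insert in \<open>auto intro: module_span_scale\<close>)
  then show ?case using insert.hyps by simp
qed (simp_all add: module_span.zero)

lemma module_span_image:
  assumes g: "\<And>k. k < t \<Longrightarrow> g k \<in> free_mod X r"
  shows "module_span X (g ` {..<t}) = mat_map t r g ` free_mod X t"
proof
  show "module_span X (g ` {..<t}) \<subseteq> mat_map t r g ` free_mod X t"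
  proof (rule module_span_least)
    show "g ` {..<t} \<subseteq> mat_map t r g ` free_mod X t"
    proof
      fix v assume "v \<in> g ` {..<t}"
      then obtain j where j: "j < t" "v = g j" by auto
      have "g j l = (if l < r then \<Sum>k<t. (if k = j then 1 else 0) * g k l else 0)" for l
        using j g[of j] by (auto simp: free_mod_iff if_distrib[of "\<lambda>a. a * _"] cong: if_cong)
      then have "v = mat_map t r g (\<lambda>k. if k = j then 1 else 0)"
        unfolding j(2) mat_map_def by blast
      moreover have "(\<lambda>k. if k = j then 1 else 0) \<in> (free_mod X t :: (nat \<Rightarrow> 'a mpoly) set)"
        using j by (simp add: free_mod_iff)
      ultimately show "v \<in> mat_map t r g ` free_mod X t" by blast
    qed
    show "(\<lambda>k. 0) \<in> mat_map t r g ` free_mod X t"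
      by (rule image_eqI[of _ _ "\<lambda>k. 0"]) (simp_all add: free_mod_zero)
    fix v w assume "v \<in> mat_map t r g ` free_mod X t" "w \<in> mat_map t r g ` free_mod X t"
    then show "(\<lambda>k. v k + w k) \<in> mat_map t r g ` free_mod X t"
      by (auto simp: mat_map_add[symmetric] intro!: imageI free_mod_add)
  next
    fix c :: "'a mpoly" and v assume "indets c \<subseteq> X" "v \<in> mat_map t r g ` free_mod X t"
    then show "(\<lambda>k. c * v k) \<in> mat_map t r g ` free_mod X t"
      by (auto simp: mat_map_scale[symmetric] intro!: imageI free_mod_scale)
  qed
  show "mat_map t r g ` free_mod X t \<subseteq> module_span X (g ` {..<t})"
  proof
    fix v assume "v \<in> mat_map t r g ` free_mod X t"
    then obtain c where c: "c \<in> free_mod X t" "v = mat_map t r g c" by auto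
    have "v = (\<lambda>l. \<Sum>k<t. c k * g k l)"
      unfolding c(2) mat_map_def
      using g by (auto simp: fun_eq_iff free_mod_iff intro!: sum.neutral[symmetric])
    moreover have "(\<lambda>l. \<Sum>k<t. c k * g k l) \<in> module_span X (g ` {..<t})"
      using c(1) by (intro module_span_sum module_span_base) (auto simp: free_mod_iff)
    ultimately show "v \<in> module_span X (g ` {..<t})" by simp
  qed
qed

abbreviation multihomogeneous where
  "multihomogeneous s e v \<equiv> vec_homogeneous (\<lambda>m. m) s e v"

definition multigraded_submodule ::
    "nat set \<Rightarrow> nat \<Rightarrow> (nat \<Rightarrow> nat \<Rightarrow>\<^sub>0 nat) \<Rightarrow> (nat \<Rightarrow> 'k::comm_ring_1 mpoly) set \<Rightarrow> bool" where
  "multigraded_submodule X r s N \<longleftrightarrow> N \<subseteq> free_mod X r \<and> (\<lambda>k. 0) \<in> N \<and>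
    (\<forall>v\<in>N. \<forall>w\<in>N. (\<lambda>k. v k + w k) \<in> N) \<and>
    (\<forall>c. indets c \<subseteq> X \<longrightarrow> (\<forall>v\<in>N. (\<lambda>k. c * v k) \<in> N)) \<and>
    (\<forall>v\<in>N. \<forall>e. vec_comp (\<lambda>m. m) s e v \<in> N)"

lemma multigraded_submoduleD:
  assumes "multigraded_submodule X r s N"
  shows "N \<subseteq> free_mod X r" "(\<lambda>k. 0) \<in> N"
    "\<And>v w. v \<in> N \<Longrightarrow> w \<in> N \<Longrightarrow> (\<lambda>k. v k + w k) \<in> N"
    "\<And>c v. indets c \<subseteq> X \<Longrightarrow> v \<in> N \<Longrightarrow> (\<lambda>k. c * v k) \<in> N"
    "\<And>v e. v \<in> N \<Longrightarrow> vec_comp (\<lambda>m. m) s e v \<in> N"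
  using assms unfolding multigraded_submodule_def by (elim conjE; blast)+

lemma span_subset_submodule:
  "multigraded_submodule X r s N \<Longrightarrow> G \<subseteq> N \<Longrightarrow> module_span X G \<subseteq> N"
  by (rule module_span_least) (simp_all add: multigraded_submoduleD)

text \<open>Induction on the rank. The last coordinates of the elements of \<open>N\<close> form a monomial ideal
because \<open>N\<close> contains the homogeneous components of its elements; Dickson's lemma yields finitely many elements of \<open>N\<close>
whose last coordinates are monomials generating this ideal. Subtracting a combination of them
moves any element of \<open>N\<close> into the submodule with last coordinate zero.\<close>
lemma multigraded_submodule_fg:
  fixes N :: "(nat \<Rightarrow> 'k::field mpoly) set"
  assumes X: "finite X" and "multigraded_submodule X r s N"
  shows "\<exists>G. finite G \<and> G \<subseteq> N \<and> (\<forall>g\<in>G. \<exists>e. multihomogeneous s e g) \<and> N \<subseteq> module_span X G"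
  using assms(2)
proof (induction r arbitrary: N)
  case 0
  have "N \<subseteq> {\<lambda>k. 0}"
    using multigraded_submoduleD(1)[OF 0] by (auto simp: free_mod_iff fun_eq_iff subset_iff)
  then show ?case by (intro exI[of _ "{}"]) (auto intro: module_span.zero)
next
  case (Suc r)
  note N = multigraded_submoduleD[OF Suc.prems]
  have "multigraded_submodule X r s {v \<in> N. v r = 0}"
    unfolding multigraded_submodule_def
  proof (intro conjI ballI allI impI)
    show "{v \<in> N. v r = 0} \<subseteq> free_mod X r"
    proof
      fix v assume "v \<in> {v \<in> N. v r = 0}"
      then have "v \<in> free_mod X (Suc r)" "v r = 0" using N(1) by auto
      then show "v \<in> free_mod X r"
        by (auto simp: free_mod_iff) (metis le_neq_implies_less Suc_leI)
    qed
  qed (use N in \<open>auto simp: vec_comp_def\<close>)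
  from Suc.IH[OF this] obtain G where G: "finite G" "G \<subseteq> {v \<in> N. v r = 0}"
    "\<forall>g\<in>G. \<exists>e. multihomogeneous s e g" "{v \<in> N. v r = 0} \<subseteq> module_span X G" by blast
  define L where "L = {m. keys m \<subseteq> X \<and> (\<exists>v\<in>N. multihomogeneous s (m + s r) v \<and> v r = single m 1)}"
  obtain M where M: "M \<subseteq> L" "finite M" "\<forall>m\<in>L. \<exists>m0\<in>M. \<forall>i\<in>X. lookup m0 i \<le> lookup m i"
    using dickson[OF X] by blast
  have "\<forall>m\<in>M. \<exists>v. v \<in> N \<and> multihomogeneous s (m + s r) v \<and> v r = single m 1"
    using M(1) unfolding L_def by blast
  then obtain h where h: "\<And>m. m \<in> M \<Longrightarrow> h m \<in> N"
    "\<And>m. m \<in> M \<Longrightarrow> multihomogeneous s (m + s r) (h m)" "\<And>m. m \<in> M \<Longrightarrow> h m r = single m 1"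
    by metis
  \<comment> \<open>the component of \<open>v\<close> in degree \<open>m + s r\<close> has the single term \<open>m\<close> in the last coordinate\<close>
  have leading: "m \<in> L" if v: "v \<in> N" and m: "m \<in> keys (v r)" for v m
  proof -
    define c where "c = lookup (v r) m"
    define w where "w = vec_comp (\<lambda>m. m) s (m + s r) v"
    have "w r = filter_keys (\<lambda>m'. m' = m) (v r)"
      by (simp add: w_def vec_comp_def)
    also have "\<dots> = single m c"
      by (rule poly_mapping_eqI) (auto simp: lookup_filter_keys c_def lookup_single when_def)
    finally have wr: "w r = single m c" .
    let ?u = "\<lambda>k. single 0 (inverse c) * w k"
    have "w \<in> N" unfolding w_def by (rule N(5)[OF v])
    then have "?u \<in> N" by (intro N(4) indets_single) auto
    moreover have "?u r = single m 1"
      using m by (simp add: wr mult_single c_def in_keys_iff)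
    moreover have "multihomogeneous s (m + s r) ?u"
      using vec_homogeneous_comp[of "\<lambda>m. m" s "m + s r" v]
      by (auto simp: vec_homogeneous_def w_def elim!: keys_mult_obtain split: if_splits)
    moreover have "keys m \<subseteq> X"
      using subsetD[OF N(1) v] m unfolding free_mod_iff indets_subset_iff by blast
    ultimately show ?thesis unfolding L_def by blast
  qed
  have lift: "\<exists>u\<in>module_span X (h ` M). u r = single m 1" if m: "m \<in> L" for m
  proof -
    obtain m0 where m0: "m0 \<in> M" "\<forall>i\<in>X. lookup m0 i \<le> lookup m i" using M(3) m by blast
    have "keys m0 \<subseteq> X" using m0(1) M(1) by (auto simp: L_def)
    then have "lookup m0 i \<le> lookup m i" for i
      using m0(2) by (metis in_keys_iff subsetD zero_le)
    then have eq: "m - m0 + m0 = m"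
      by (intro poly_mapping_eqI) (simp add: lookup_add lookup_minus)
    have "keys (m - m0) \<subseteq> keys m" by (auto simp: in_keys_iff lookup_minus)
    then have "indets (single (m - m0) (1::'k)) \<subseteq> X"
      using m by (intro indets_single) (auto simp: L_def)
    then have "(\<lambda>k. single (m - m0) 1 * h m0 k) \<in> module_span X (h ` M)"
      using m0(1) by (intro module_span_scale module_span_base) auto
    moreover have "single (m - m0) 1 * h m0 r = single m 1"
      by (simp add: h(3)[OF m0(1)] mult_single eq)
    ultimately show ?thesis by (intro bexI)
  qed
  have sub: "module_span X (h ` M) \<subseteq> N"
    using h(1) by (intro span_subset_submodule[OF Suc.prems]) auto
  have "N \<subseteq> module_span X (G \<union> h ` M)"
  proof
    fix v assume v: "v \<in> N"
    have "\<forall>m\<in>keys (v r). \<exists>u. u \<in> module_span X (h ` M) \<and> u r = single m 1"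
      using leading[OF v] lift by blast
    then obtain U where U: "\<And>m. m \<in> keys (v r) \<Longrightarrow> U m \<in> module_span X (h ` M)"
      "\<And>m. m \<in> keys (v r) \<Longrightarrow> U m r = single m 1" by metis
    define u where "u = (\<lambda>k. \<Sum>m\<in>keys (v r). single 0 (lookup (v r) m) * U m k)"
    have u: "u \<in> module_span X (h ` M)"
      unfolding u_def by (intro module_span_sum U indets_single) auto
    have "u r = (\<Sum>m\<in>keys (v r). single m (lookup (v r) m))"
      by (simp add: u_def U(2) mult_single)
    then have ur: "u r = v r" using poly_mapping_sum_single[of "v r"] by simp
    have "(\<lambda>k. v k + (- 1) * u k) \<in> N"
      using sub u by (intro N(3)[OF v] N(4)) auto
    then have "(\<lambda>k. v k - u k) \<in> module_span X G"
      using G(4) ur by auto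
    then have "(\<lambda>k. v k - u k) \<in> module_span X (G \<union> h ` M)"
      using module_span_mono[of G "G \<union> h ` M"] by blast
    moreover have "u \<in> module_span X (G \<union> h ` M)"
      using module_span_mono[of "h ` M" "G \<union> h ` M"] u by blast
    ultimately have "(\<lambda>k. (v k - u k) + u k) \<in> module_span X (G \<union> h ` M)"
      by (rule module_span_add)
    then show "v \<in> module_span X (G \<union> h ` M)" by simp
  qed
  moreover have "finite (G \<union> h ` M)" using G(1) M(2) by simp
  moreover have "G \<union> h ` M \<subseteq> N" using G(2) h(1) by auto
  moreover have "\<forall>g\<in>G \<union> h ` M. \<exists>e. multihomogeneous s e g" using G(3) h(2) by blast
  ultimately show ?case by blast
qed

section \<open>Minimal free resolutions\<close>

text \<open>A homogeneous generating set of least cardinality will do: if some relation had a coefficient with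
nonzero constant term at the \<open>j\<close>-th generator, then its component in the degree of that generator
would have a nonzero field element as \<open>j\<close>-th coefficient and would express the generator by the others.\<close>
lemma minimal_generators:
  fixes N :: "(nat \<Rightarrow> 'k::field mpoly) set"
  assumes X: "finite X" and N: "multigraded_submodule X r s N"
  shows "\<exists>t b g. (\<forall>k<t. g k \<in> N \<and> multihomogeneous s (b k) (g k)) \<and>
    N = mat_map t r g ` free_mod X t \<and>
    (\<forall>c\<in>free_mod X t. mat_map t r g c = (\<lambda>_. 0) \<longrightarrow> (\<forall>k. lookup (c k) 0 = 0))"
proof -
  define P where "P G \<longleftrightarrow> finite G \<and> G \<subseteq> N \<and> (\<forall>g\<in>G. \<exists>e. multihomogeneous s e g) \<and>
    N \<subseteq> module_span X G" for G
  obtain G0 where "P G0" using multigraded_submodule_fg[OF assms] unfolding P_def by blast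
  then obtain G where G: "P G" and minimal: "\<And>H. P H \<Longrightarrow> card G \<le> card H"
    using ex_has_least_nat[of P G0 card] by blast
  have finG: "finite G" and GN: "G \<subseteq> N" and span: "N \<subseteq> module_span X G"
    using G by (auto simp: P_def)
  define t where "t = card G"
  obtain g where g: "bij_betw g {..<t} G"
    using ex_bij_betw_nat_finite[OF finG] by (auto simp: t_def atLeast0LessThan)
  have gG: "g k \<in> G" if "k < t" for k using g that by (auto simp: bij_betw_def)
  have imG: "g ` {..<t} = G" using g by (simp add: bij_betw_def)
  have "\<forall>k. \<exists>e. k < t \<longrightarrow> multihomogeneous s e (g k)" using gG G by (auto simp: P_def)
  then obtain b where b: "\<And>k. k < t \<Longrightarrow> multihomogeneous s (b k) (g k)" by metis
  have gF: "g k \<in> free_mod X r" if "k < t" for k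
    using gG[OF that] GN multigraded_submoduleD(1)[OF N] by blast
  have "N = module_span X G" using span span_subset_submodule[OF N GN] by blast
  then have NI: "N = mat_map t r g ` free_mod X t"
    using module_span_image[of t g X r, OF gF] imG by simp
  have "lookup (c j) 0 = 0" if c: "c \<in> free_mod X t" "mat_map t r g c = (\<lambda>_. 0)" for c j
  proof (rule ccontr)
    assume j: "lookup (c j) 0 \<noteq> 0"
    then have jt: "j < t" using c(1) by (metis free_mod_iff linorder_le_less_linear lookup_zero)
    define a where "a = lookup (c j) 0"
    define c' where "c' = vec_comp (\<lambda>m. m) b (b j) c"
    have "mat_map t r g c' = vec_comp (\<lambda>m. m) s (b j) (mat_map t r g c)"
      unfolding c'_def
      by (rule vec_comp_mat_map[symmetric]) (use b in \<open>auto simp: vec_homogeneous_def\<close>)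
    then have 0: "mat_map t r g c' = (\<lambda>_. 0)" using c(2) by simp
    have c'X: "indets (c' k) \<subseteq> X" for k
      using vec_comp_in_free_mod[OF c(1), of "\<lambda>m. m" b "b j"] unfolding c'_def free_mod_iff by blast
    have c'j: "c' j = single 0 a"
      by (rule poly_mapping_eqI)
         (auto simp: c'_def vec_comp_def lookup_filter_keys a_def lookup_single when_def)
    have eq: "g j l = (\<Sum>k\<in>{..<t} - {j}. (single 0 (- inverse a) * c' k) * g k l)" for l
    proof (cases "l < r")
      case True
      have "(\<Sum>k<t. c' k * g k l) = 0" using fun_cong[OF 0, of l] True by (simp add: mat_map_def)
      then have "single 0 a * g j l = - (\<Sum>k\<in>{..<t} - {j}. c' k * g k l)"
        using jt by (simp add: sum.remove[of "{..<t}" j] c'j eq_neg_iff_add_eq_0)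
      then have "single 0 (- inverse a) * (single 0 a * g j l)
          = single 0 (- inverse a) * - (\<Sum>k\<in>{..<t} - {j}. c' k * g k l)" by simp
      moreover have "single 0 (- inverse a) * (single 0 a * g j l) = - g j l"
        using j by (simp add: mult.assoc[symmetric] mult_single a_def single_uminus)
      ultimately show ?thesis
        by (simp add: sum_distrib_left mult.assoc)
    next
      case False
      then show ?thesis using gF jt by (auto simp: free_mod_iff intro!: sum.neutral[symmetric])
    qed
    have "(\<lambda>l. \<Sum>k\<in>{..<t} - {j}. (single 0 (- inverse a) * c' k) * g k l)
        \<in> module_span X (G - {g j})"
    proof (intro module_span_sum module_span_base indets_mult indets_single c'X)
      fix k assume "k \<in> {..<t} - {j}"
      then show "g k \<in> G - {g j}"
        using gG g jt by (auto simp: bij_betw_def dest: inj_onD)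
    qed auto
    then have gj: "g j \<in> module_span X (G - {g j})" by (simp add: eq[symmetric])
    have "G \<subseteq> module_span X (G - {g j})" using gj module_span_base[of _ "G - {g j}"] by blast
    then have "N \<subseteq> module_span X (G - {g j})" using span module_span_trans by blast
    then have "P (G - {g j})" using G by (auto simp: P_def)
    then have "card G \<le> card (G - {g j})" by (rule minimal)
    then show False using card_Diff1_less[OF finG gG[OF jt]] by simp
  qed
  then show ?thesis
    using NI b gG GN by (intro exI[of _ t] exI[of _ b] exI[of _ g]) blast
qed

lemma multigraded_kernel:
  assumes g: "\<And>k. k < t \<Longrightarrow> multihomogeneous s (b k) (g k)"
  shows "multigraded_submodule X t b {c \<in> free_mod X t. mat_map t r g c = (\<lambda>_. 0)}"
proof -
  have "mat_map t r g (vec_comp (\<lambda>m. m) b e c) = vec_comp (\<lambda>m. m) s e (mat_map t r g c)" for e c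
    by (rule vec_comp_mat_map[symmetric]) (use g in \<open>auto simp: vec_homogeneous_def\<close>)
  then show ?thesis
    by (auto simp: multigraded_submodule_def free_mod_zero free_mod_add free_mod_scale
      vec_comp_in_free_mod mat_map_add mat_map_scale)
qed

lemma mon_ideal_filter_keys: "f \<in> mon_ideal X U \<Longrightarrow> filter_keys Q f \<in> mon_ideal X U"
  by (auto simp: mon_ideal_def indets_subset_iff)

text \<open>Each stage presents the kernel of the previous map by minimal generators; the kernel of a
homogeneous matrix is again multigraded, so the construction continues. The stages record the
exponent vectors of the generators, whose total degrees are the shifts of the resolution. That the relations
among minimal generators have no constant terms is exactly the minimality of the resolution.\<close>
theorem minimal_resolution_exists:
  fixes J :: "'k::field mpoly set"
  assumes X: "finite X" and J: "ideal J (poly_ring X)" "J = mon_ideal X U"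
  shows "\<exists>F. minimal_graded_free_resolution X J F"
proof -
  \<comment> \<open>the ideal, regarded as a submodule of the free module of rank one\<close>
  define N where "N = {v. v (0::nat) \<in> J \<and> (\<forall>k>0. v k = (0::'k mpoly))}"
  have N: "multigraded_submodule X 1 (\<lambda>_. 0) N"
    unfolding multigraded_submodule_def
  proof (intro conjI ballI allI impI)
    show "N \<subseteq> free_mod X 1"
    proof
      fix v assume v: "v \<in> N"
      have "indets (v k) \<subseteq> X" for k
        using v ideal_polyD(4)[OF J(1)] by (cases k) (auto simp: N_def)
      then show "v \<in> free_mod X 1" using v by (simp add: free_mod_iff N_def)
    qed
    show "(\<lambda>k. 0) \<in> N" using ideal_polyD(1)[OF J(1)] by (simp add: N_def)
    show "(\<lambda>k. v k + w k) \<in> N" if "v \<in> N" "w \<in> N" for v w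
      using that ideal_polyD(2)[OF J(1)] by (simp add: N_def)
    show "(\<lambda>k. c * v k) \<in> N" if "indets c \<subseteq> X" "v \<in> N" for c v
      using that ideal_polyD(3)[OF J(1)] by (simp add: N_def)
    show "vec_comp (\<lambda>m. m) (\<lambda>_. 0) e v \<in> N" if "v \<in> N" for e v
      using that mon_ideal_filter_keys[of "v 0" X U] by (simp add: N_def vec_comp_def J(2))
  qed
  define K where "K r t g = {c \<in> free_mod X t. mat_map t r g c = (\<lambda>_. 0 :: 'k mpoly)}" for r t g
  define stage where "stage r s t b g \<longleftrightarrow>
    (\<forall>k<t. g k \<in> free_mod X r \<and> multihomogeneous s (b k) (g k)) \<and>
    (\<forall>c\<in>K r t g. \<forall>k. lookup (c k) 0 = 0)"
    for r t and s b :: "nat \<Rightarrow> nat \<Rightarrow>\<^sub>0 nat" and g :: "nat \<Rightarrow> nat \<Rightarrow> 'k mpoly"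
  \<comment> \<open>a stage is a map \<open>g\<close> from a free module of rank \<open>t\<close> with degrees \<open>b\<close> to one of rank \<open>r\<close> with degrees \<open>s\<close>\<close>
  define P where "P = (\<lambda>(n::nat) (r, s, t, b, g). stage r s t b g \<and>
    (n = 0 \<longrightarrow> r = 1 \<and> s = (\<lambda>_. 0) \<and> mat_map t r g ` free_mod X t = N))"
  define Q where "Q = (\<lambda>(n::nat) (r, s :: nat \<Rightarrow> nat \<Rightarrow>\<^sub>0 nat, t, b :: nat \<Rightarrow> nat \<Rightarrow>\<^sub>0 nat, g)
      (r', s', t', b' :: nat \<Rightarrow> nat \<Rightarrow>\<^sub>0 nat, g').
    r' = t \<and> s' = b \<and> mat_map t' t g' ` free_mod X t' = K r t g \<and> (\<forall>k<t'. g' k \<in> K r t g))"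
  have generators: "\<exists>t b g. stage r s t b g \<and> N' = mat_map t r g ` free_mod X t \<and> (\<forall>k<t. g k \<in> N')"
    if N': "multigraded_submodule X r s N'" for r s N'
  proof -
    from minimal_generators[OF X N'] obtain t b g
      where g: "\<forall>k<t. g k \<in> N' \<and> multihomogeneous s (b k) (g k)"
        "N' = mat_map t r g ` free_mod X t"
        "\<forall>c\<in>free_mod X t. mat_map t r g c = (\<lambda>_. 0) \<longrightarrow> (\<forall>k. lookup (c k) 0 = 0)"
      by (elim exE conjE)
    have "stage r s t b g"
      unfolding stage_def K_def using g(1,3) multigraded_submoduleD(1)[OF N'] by auto
    with g(1,2) show ?thesis by blast
  qed
  have "\<exists>f. \<forall>n. P n (f n) \<and> Q n (f n) (f (Suc n))"
  proof (rule dependent_nat_choice)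
    from generators[OF N] obtain t b g where
      "stage 1 (\<lambda>_. 0) t b g" "N = mat_map t 1 g ` free_mod X t" by (elim exE conjE)
    then show "\<exists>x. P 0 x"
      by (intro exI[of _ "(1, \<lambda>_. 0, t, b, g)"]) (simp add: P_def)
  next
    fix x n assume "P n x"
    obtain r s t b g where x: "x = (r, s, t, b, g)" by (metis prod_cases5)
    have "multigraded_submodule X t b (K r t g)"
      unfolding K_def using \<open>P n x\<close>
      by (intro multigraded_kernel[where s = s]) (auto simp: P_def x stage_def)
    from generators[OF this] obtain t' b' g' where "stage t b t' b' g'"
      "K r t g = mat_map t' t g' ` free_mod X t'" "\<forall>k<t'. g' k \<in> K r t g"
      by (elim exE conjE)
    then show "\<exists>y. P (Suc n) y \<and> Q n x y"
      unfolding x P_def Q_def by (intro exI[of _ "(t, b, t', b', g')"]) simp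
  qed
  then obtain f where f: "\<And>n. P n (f n)" "\<And>n. Q n (f n) (f (Suc n))" by blast
  define R where "R n = fst (f n)" for n
  define S where "S n = fst (snd (f n))" for n
  define T where "T n = fst (snd (snd (f n)))" for n
  define B where "B n = fst (snd (snd (snd (f n))))" for n
  define g where "g n = snd (snd (snd (snd (f n))))" for n
  have feq: "f n = (R n, S n, T n, B n, g n)" for n
    by (simp add: R_def S_def T_def B_def g_def)
  have st: "stage (R n) (S n) (T n) (B n) (g n)" for n
    using f(1)[of n] by (simp add: P_def feq)
  have base: "R 0 = 1" "S 0 = (\<lambda>_. 0)" "mat_map (T 0) 1 (g 0) ` free_mod X (T 0) = N"
    using f(1)[of 0] by (auto simp: P_def feq)
  have succ: "R (Suc n) = T n" "S (Suc n) = B n"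
    "mat_map (T (Suc n)) (T n) (g (Suc n)) ` free_mod X (T (Suc n)) = K (R n) (T n) (g n)"
    "\<And>k. k < T (Suc n) \<Longrightarrow> g (Suc n) k \<in> K (R n) (T n) (g n)" for n
    using f(2)[of n] by (auto simp: Q_def feq)
  have gX: "indets (g n k l) \<subseteq> X" if "k < T n" for n k l
    using st[of n] that by (simp add: stage_def free_mod_iff)
  have hom: "m + S n l = B n k" if "k < T n" "m \<in> keys (g n k l)" for n k l m
    using st[of n] that by (auto simp: stage_def vec_homogeneous_def)
  define F where "F = \<lparr>rank = T, shift = (\<lambda>i k. mon_deg (B i k)), diff = (\<lambda>i. g (Suc i)),
    aug = (\<lambda>k. g 0 k 0)\<rparr>"
  have F: "rank F = T" "shift F i k = mon_deg (B i k)" "diff F i = g (Suc i)" "aug F k = g 0 k 0" for i k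
    by (simp_all add: F_def)
  have dF: "diff_map F i = mat_map (T (Suc i)) (T i) (g (Suc i))" for i
    by (simp add: diff_map_eq_mat_map F)
  have aug: "mat_map (T 0) 1 (g 0) v = (\<lambda>l. if l = 0 then aug_map F v else 0)" for v
    by (auto simp: mat_map_def aug_map_def F fun_eq_iff)
  have "aug_map F ` free_mod X (T 0) = (\<lambda>v. v 0) ` (mat_map (T 0) 1 (g 0) ` free_mod X (T 0))"
    unfolding aug image_image by simp
  also have "\<dots> = J"
  proof -
    have "x \<in> (\<lambda>v. v 0) ` N" if "x \<in> J" for x
      by (rule image_eqI[of _ _ "\<lambda>k. if k = 0 then x else 0"]) (use that in \<open>auto simp: N_def\<close>)
    then show ?thesis unfolding base(3) by (auto simp: N_def)
  qed
  finally have imJ: "aug_map F ` free_mod X (T 0) = J" .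
  have "aug_map F v = 0 \<longleftrightarrow> mat_map (T 0) (R 0) (g 0) v = (\<lambda>_. 0)" for v
    unfolding base(1) aug by (auto simp: fun_eq_iff)
  then have ker0: "{v \<in> free_mod X (T 0). aug_map F v = 0} = diff_map F 0 ` free_mod X (T (Suc 0))"
    unfolding dF succ(3) K_def by simp
  have ker: "{v \<in> free_mod X (T (Suc i)). diff_map F i v = (\<lambda>_. 0)} =
      diff_map F (Suc i) ` free_mod X (T (Suc (Suc i)))" for i
    unfolding dF succ(3) K_def succ(1) by simp
  have entry: "g (Suc i) k l \<in> Idl\<^bsub>poly_ring X\<^esub> (Var ` X)" if k: "k < T (Suc i)" for i k l
  proof -
    have "lookup (g (Suc i) k l) 0 = 0"
      using st[of i] succ(4)[OF k] by (simp add: stage_def)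
    moreover have "m = 0" if "keys m \<subseteq> X" "deg_in X m = 0" for m
    proof (rule poly_mapping_eqI)
      fix j
      have "\<forall>i\<in>X. lookup m i = 0" using that(2) X by (simp add: deg_in_def)
      then show "lookup m j = lookup 0 j" using that(1) by (auto simp: in_keys_iff)
    qed
    ultimately have "1 \<le> deg_in X m" if "m \<in> keys (g (Suc i) k l)" for m
      using that gX[OF k, of l] by (metis One_nat_def Suc_leI in_keys_iff indets_subset_iff neq0_conv)
    then show ?thesis
      unfolding genideal_Var[OF X order_refl] using gX[OF k, of l] by (auto simp: mon_ideal_def)
  qed
  have "homogeneous (mon_deg (B 0 k)) (g 0 k 0)" if "k < T 0" for k
    unfolding homogeneous_def using hom[OF that] base(2) by fastforce
  moreover have "mon_deg m + mon_deg (B i l) = mon_deg (B (Suc i) k)"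
    if "k < T (Suc i)" "m \<in> keys (g (Suc i) k l)" for i k l m
    using hom[OF that] by (metis mon_deg_add succ(2))
  ultimately have "minimal_graded_free_resolution X J F"
    unfolding minimal_graded_free_resolution_def graded_free_resolution_def F
    using gX imJ ker0 ker entry by (simp add: F(1))
  then show ?thesis by blast
qed


section \<open>Regularity and socle degree\<close>

lemma minimal_resolutionD:
  assumes X: "finite X" and F: "minimal_graded_free_resolution X J F"
  shows "acyclic_complex X F" "minimal_entries F" "graded_entries F"
    "\<And>k. k < rank F 0 \<Longrightarrow> indets (aug F k) \<subseteq> X"
    "\<And>k m. k < rank F 0 \<Longrightarrow> m \<in> keys (aug F k) \<Longrightarrow> mon_deg m = shift F 0 k"
    "aug_map F ` free_mod X (rank F 0) = J"
    "{v \<in> free_mod X (rank F 0). aug_map F v = 0} = diff_map F 0 ` free_mod X (rank F (Suc 0))"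
proof -
  note F' = F[unfolded minimal_graded_free_resolution_def graded_free_resolution_def]
  show "acyclic_complex X F" "graded_entries F"
    using F' by (simp_all add: acyclic_complex_def graded_entries_def)
  show "\<And>k. k < rank F 0 \<Longrightarrow> indets (aug F k) \<subseteq> X"
    "\<And>k m. k < rank F 0 \<Longrightarrow> m \<in> keys (aug F k) \<Longrightarrow> mon_deg m = shift F 0 k"
    "aug_map F ` free_mod X (rank F 0) = J"
    "{v \<in> free_mod X (rank F 0). aug_map F v = 0} = diff_map F 0 ` free_mod X (rank F (Suc 0))"
    using F' by (simp_all add: homogeneous_def)
  show "minimal_entries F"
    unfolding minimal_entries_def
  proof (intro allI impI)
    fix i k l assume "k < rank F (Suc i)" "l < rank F i"
    then have "diff F i k l \<in> mon_power X X 1"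
      using F' unfolding genideal_Var[OF X order_refl] by simp
    then have "0 \<notin> keys (diff F i k l)" by (auto simp: mon_ideal_def deg_in_def)
    then show "lookup (diff F i k l) 0 = 0" by (simp add: in_keys_iff)
  qed
qed

text \<open>The resolution of the quotient ring: the polynomial ring is placed in front, at position zero.\<close>
definition augmented :: "'k::comm_ring_1 mpoly free_res \<Rightarrow> 'k mpoly free_res" where
  "augmented F = \<lparr>rank = case_nat 1 (rank F), shift = case_nat (\<lambda>_. 0) (shift F),
     diff = case_nat (\<lambda>k l. aug F k) (diff F), aug = aug F\<rparr>"

lemma augmented_simps [simp]:
  "rank (augmented F) 0 = 1" "rank (augmented F) (Suc i) = rank F i"
  "shift (augmented F) 0 k = 0" "shift (augmented F) (Suc i) = shift F i"
  "diff (augmented F) 0 k l = aug F k" "diff (augmented F) (Suc i) = diff F i"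
  by (simp_all add: augmented_def)

lemma diff_map_augmented:
  "diff_map (augmented F) 0 v = (\<lambda>l. if l = 0 then aug_map F v else 0)"
  "diff_map (augmented F) (Suc i) = diff_map F i"
  by (simp_all add: diff_map_def aug_map_def fun_eq_iff)

lemma acyclic_augmented:
  assumes X: "finite X" and F: "minimal_graded_free_resolution X J F"
  shows "acyclic_complex X (augmented F)" "graded_entries (augmented F)"
proof -
  note D = minimal_resolutionD[OF X F]
  show "acyclic_complex X (augmented F)"
    unfolding acyclic_complex_def
  proof (intro conjI allI impI)
    fix i k l assume "k < rank (augmented F) (Suc i)" "l < rank (augmented F) i"
    then show "indets (diff (augmented F) i k l) \<subseteq> X"
      using D(4) D(1) by (cases i) (simp_all add: acyclic_complex_def)
  next
    fix i
    show "{v \<in> free_mod X (rank (augmented F) (Suc i)). diff_map (augmented F) i v = (\<lambda>_. 0)} =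
      diff_map (augmented F) (Suc i) ` free_mod X (rank (augmented F) (Suc (Suc i)))"
    proof (cases i)
      case 0
      have "(\<lambda>l. if l = (0::nat) then a else 0) = (\<lambda>_. 0) \<longleftrightarrow> a = 0" for a :: "'a mpoly"
        by (auto simp: fun_eq_iff)
      then show ?thesis using D(7) by (simp add: 0 diff_map_augmented)
    next
      case (Suc j)
      then show ?thesis using acyclic_complexD[OF D(1), of j] by (simp add: diff_map_augmented)
    qed
  qed
  show "graded_entries (augmented F)"
    unfolding graded_entries_def
  proof (intro allI impI ballI)
    fix i k l m assume "k < rank (augmented F) (Suc i)" "l < rank (augmented F) i"
      "m \<in> keys (diff (augmented F) i k l)"
    then show "mon_deg m + shift (augmented F) i l = shift (augmented F) (Suc i) k"
      using D(5) D(3) by (cases i) (simp_all add: graded_entries_def)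
  qed
qed

text \<open>The socle element contributes a Betti number at place \<open>|X|\<close> of the resolution of the quotient ring, which is place
\<open>|X| - 1\<close> for the ideal, of degree \<open>d - 1 + |X|\<close>; the difference is \<open>d\<close>. For the equivalence,
generators of \<open>J\<close> sit at place zero, so their degrees are at most the regularity and at least \<open>d\<close>; and
\<open>J\<close> has an element of degree exactly \<open>d\<close>, so a linear resolution cannot start later than \<open>d\<close>.\<close>
theorem regularity_of_socle:
  fixes J :: "'k::field mpoly set"
  assumes X: "finite X" "X \<noteq> {}"
    and J: "ideal J (poly_ring X)" "J = mon_ideal X U"
    and degJ: "\<And>m. m \<in> U \<Longrightarrow> keys m \<subseteq> X \<Longrightarrow> d \<le> mon_deg m"
    and m0: "keys m0 \<subseteq> X" "Suc (mon_deg m0) = d" "single m0 1 \<notin> J"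
    and socle: "\<And>x. x \<in> X \<Longrightarrow> Var x * single m0 1 \<in> J"
  shows "int d \<le> reg X J" "int d = reg X J \<longleftrightarrow> linear_resolution X J"
proof -
  interpret R: cring "poly_ring X :: 'k mpoly ring" by (rule cring_poly_ring)
  define F where "F = (SOME F. minimal_graded_free_resolution X J F)"
  have F: "minimal_graded_free_resolution X J F"
    unfolding F_def using minimal_resolution_exists[OF X(1) J] by (rule someI_ex)
  note D = minimal_resolutionD[OF X(1) F]
  define S where "S = {int j - int i | i j. graded_betti X J i j \<noteq> 0}"
  have betti: "graded_betti X J i j = card {k. k < rank F i \<and> shift F i k = j}" for i j
    by (simp add: graded_betti_def F_def Let_def)
  have inS: "int (shift F i k) - int i \<in> S" if "k < rank F i" for i k
  proof -
    have "k \<in> {k'. k' < rank F i \<and> shift F i k' = shift F i k}" using that by simp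
    then have "graded_betti X J i (shift F i k) \<noteq> 0" unfolding betti by (auto simp: card_eq_0_iff)
    then show ?thesis unfolding S_def by blast
  qed
  have "S \<subseteq> (\<lambda>(i, k). int (shift F i k) - int i) ` (SIGMA i:{..card X}. {..<rank F i})"
  proof
    fix z assume "z \<in> S"
    then obtain i j where ij: "z = int j - int i" "graded_betti X J i j \<noteq> 0" by (auto simp: S_def)
    then have "{k. k < rank F i \<and> shift F i k = j} \<noteq> {}" unfolding betti by (metis card.empty)
    then obtain k where k: "k < rank F i" "shift F i k = j" by auto
    then have "i \<le> card X"
      using minimal_acyclic_complex_length[OF X(1) D(1,2), of i] by (cases "card X < i") auto
    then show "z \<in> (\<lambda>(i, k). int (shift F i k) - int i) ` (SIGMA i:{..card X}. {..<rank F i})"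
      using k ij(1) by (intro image_eqI[of _ _ "(i, k)"]) auto
  qed
  then have finS: "finite S" by (rule finite_subset) auto
  have reg: "reg X J = Max S" by (simp add: reg_def S_def)
  have le_reg: "int (shift F i k) - int i \<le> reg X J" if "k < rank F i" for i k
    unfolding reg using Max_ge[OF finS inS[OF that]] .

  define f where "f = (\<lambda>k::nat. if k = 0 then single m0 (1::'k) else 0)"
  have "\<exists>k<rank (augmented F) (card X). shift (augmented F) (card X) k = mon_deg m0 + card X"
  proof (rule socle_degree[OF X(1) acyclic_augmented[OF X(1) F]])
    show "f \<in> free_mod X (rank (augmented F) 0)"
      using m0(1) by (simp add: free_mod_iff f_def indets_single)
    show "vec_homogeneous mon_deg (shift (augmented F) 0) (mon_deg m0) f"
      by (auto simp: vec_homogeneous_def f_def)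
    show "f \<notin> diff_map (augmented F) 0 ` free_mod X (rank (augmented F) 1)"
    proof
      assume "f \<in> diff_map (augmented F) 0 ` free_mod X (rank (augmented F) 1)"
      then obtain v where "v \<in> free_mod X (rank F 0)" "f = diff_map (augmented F) 0 v" by auto
      then have "f 0 \<in> J" using D(6) by (auto simp: diff_map_augmented)
      then show False using m0(3) by (simp add: f_def)
    qed
    fix x assume "x \<in> X"
    then obtain v where v: "v \<in> free_mod X (rank F 0)" "Var x * single m0 1 = aug_map F v"
      using socle D(6) by blast
    then have "(\<lambda>k. Var x * f k) = diff_map (augmented F) 0 v"
      by (auto simp: f_def diff_map_augmented)
    then show "(\<lambda>k. Var x * f k) \<in> diff_map (augmented F) 0 ` free_mod X (rank (augmented F) 1)"
      using v(1) by auto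
  qed
  moreover obtain c where c: "card X = Suc c"
    using X by (metis card_gt_0_iff gr0_conv_Suc)
  ultimately obtain k where "k < rank F c" "shift F c k = d + c"
    using m0(2) by auto
  then show ge: "int d \<le> reg X J" using le_reg[of k c] by simp

  show "int d = reg X J \<longleftrightarrow> linear_resolution X J"
  proof
    assume d: "int d = reg X J"
    define G where "G = aug F ` {..<rank F 0}"
    have GX: "G \<subseteq> carrier (poly_ring X)" using D(4) by (auto simp: G_def)
    have GJ: "aug F k \<in> J" if "k < rank F 0" for k
    proof -
      have "(\<lambda>l. if l = k then 1 else 0) \<in> (free_mod X (rank F 0) :: (nat \<Rightarrow> 'k mpoly) set)"
        using that by (simp add: free_mod_iff)
      moreover have "aug_map F (\<lambda>l. if l = k then 1 else 0) = aug F k"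
        using that by (simp add: aug_map_def if_distrib[of "\<lambda>a. a * _"] cong: if_cong)
      ultimately show ?thesis using D(6) by (metis imageI)
    qed
    have "homogeneous d (aug F k)" if k: "k < rank F 0" for k
      unfolding homogeneous_def
    proof
      fix m assume m: "m \<in> keys (aug F k)"
      have "d \<le> mon_deg m"
        using GJ[OF k] m J(2) by (intro degJ) (auto simp: mon_ideal_def indets_subset_iff)
      moreover have "int (shift F 0 k) \<le> int d" using le_reg[OF k] d by simp
      ultimately show "mon_deg m = d" using D(5)[OF k m] by simp
    qed
    then have hom: "\<forall>g\<in>G. homogeneous d g" by (auto simp: G_def)
    have "J = Idl\<^bsub>poly_ring X\<^esub> G"
    proof
      note idl = R.genideal_ideal[OF GX]
      show "J \<subseteq> Idl\<^bsub>poly_ring X\<^esub> G"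
      proof
        fix g assume "g \<in> J"
        then obtain v where v: "v \<in> free_mod X (rank F 0)" "g = aug_map F v" using D(6) by blast
        show "g \<in> Idl\<^bsub>poly_ring X\<^esub> G"
          unfolding v(2) aug_map_def
        proof (rule ideal_poly_sum[OF idl])
          fix k assume "k \<in> {..<rank F 0}"
          then show "v k * aug F k \<in> Idl\<^bsub>poly_ring X\<^esub> G"
            using v(1) R.genideal_self[OF GX]
            by (intro ideal_polyD(3)[OF idl]) (auto simp: free_mod_iff G_def)
        qed
      qed
      show "Idl\<^bsub>poly_ring X\<^esub> G \<subseteq> J"
        using GJ by (intro R.genideal_minimal J(1)) (auto simp: G_def)
    qed
    then show "linear_resolution X J"
      unfolding linear_resolution_def using hom GX d by metis
  next
    assume "linear_resolution X J"
    then obtain e G where e: "reg X J = int e" and G: "\<forall>g\<in>G. homogeneous e g"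
      "G \<subseteq> carrier (poly_ring X)" "J = Idl\<^bsub>poly_ring X\<^esub> G"
      unfolding linear_resolution_def by auto
    have "J \<subseteq> mon_ideal X {m. e \<le> mon_deg m}"
      unfolding G(3)
    proof (rule R.genideal_minimal)
      show "ideal (mon_ideal X {m. e \<le> mon_deg m} :: 'k mpoly set) (poly_ring X)"
        by (rule ideal_mon_ideal) (simp add: mon_deg_add)
      show "G \<subseteq> mon_ideal X {m. e \<le> mon_deg m}"
      proof
        fix g assume g: "g \<in> G"
        then have "indets g \<subseteq> X" using subsetD[OF G(2) g] by simp
        then show "g \<in> mon_ideal X {m. e \<le> mon_deg m}"
          using G(1) g by (auto simp: mon_ideal_def homogeneous_def)
      qed
    qed
    moreover obtain x where "x \<in> X" using X(2) by blast
    ultimately have "Var x * single m0 (1::'k) \<in> mon_ideal X {m. e \<le> mon_deg m}"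
      using socle by blast
    then have "e \<le> mon_deg (single x 1 + m0)" by (simp add: Var_times_single mon_ideal_def)
    then have "e \<le> d" using m0(2) by (simp add: mon_deg_add)
    then show "int d = reg X J" using e ge by simp
  qed
qed

section \<open>Associated primes\<close>

text \<open>Powers of monomial primes are primary. The part of \<open>g\<close> free of the variables in \<open>A\<close> and the
part of \<open>h\<close> of lowest \<open>A\<close>-degree \<open>\<mu>\<close> are nonzero, and their product is the part of \<open>g h\<close> of \<open>A\<close>-degree \<open>\<mu>\<close>.\<close>
lemma mon_power_primary:
  fixes g h :: "'k::idom mpoly"
  assumes g: "indets g \<subseteq> X" "g \<notin> mon_power X A 1" and h: "indets h \<subseteq> X" "h \<notin> mon_power X A e"
  shows "g * h \<notin> mon_power X A e"
proof -
  obtain a where a: "a \<in> keys g" "deg_in A a = 0"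
    using g by (force simp: mon_ideal_def Suc_le_eq)
  obtain b where b: "b \<in> keys h" "deg_in A b < e"
    using h by (force simp: mon_ideal_def not_le)
  define \<mu> where "\<mu> = Min (deg_in A ` keys h)"
  have min: "\<mu> \<le> deg_in A b" if "b \<in> keys h" for b
    unfolding \<mu>_def using that by (intro Min_le) auto
  have "\<mu> \<in> deg_in A ` keys h" unfolding \<mu>_def using b(1) by (intro Min_in) auto
  then obtain b' where b': "b' \<in> keys h" "deg_in A b' = \<mu>" by auto
  define g0 where "g0 = filter_keys (\<lambda>m. deg_in A m = 0) g"
  define h0 where "h0 = filter_keys (\<lambda>m. deg_in A m = \<mu>) h"
  have "a \<in> keys g0" "b' \<in> keys h0" using a b' by (auto simp: g0_def h0_def)
  then have "g0 * h0 \<noteq> 0" by (metis divisors_zero emptyE keys_zero)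
  moreover have "filter_keys (\<lambda>m. deg_in A m = \<mu>) (g0 * h) = g0 * h0"
    using filter_keys_mult[of h g0 "\<lambda>m. deg_in A m = \<mu>" "\<lambda>m. deg_in A m = \<mu>"]
    by (simp add: g0_def h0_def mult.commute)
  moreover have "filter_keys (\<lambda>m. deg_in A m = \<mu>) (filter_keys (\<lambda>m. deg_in A m \<noteq> 0) g * h) = 0"
    by (rule filter_keys_none) (use min in \<open>fastforce elim!: keys_mult_obtain\<close>)
  moreover have "g * h = g0 * h + filter_keys (\<lambda>m. deg_in A m \<noteq> 0) g * h"
    unfolding g0_def by (metis distrib_right filter_keys_split)
  ultimately have "filter_keys (\<lambda>m. deg_in A m = \<mu>) (g * h) \<noteq> 0"
    by (simp add: filter_keys_add)
  then obtain m where "m \<in> keys (filter_keys (\<lambda>m. deg_in A m = \<mu>) (g * h))"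
    by (metis keys_eq_empty ex_in_conv)
  then have "m \<in> keys (g * h)" "deg_in A m < e" using min[OF b(1)] b(2) by auto
  then show ?thesis by (auto simp: mon_ideal_def)
qed

lemma Var_power: "Var i ^ e = single (single i e) (1 :: 'k::comm_ring_1)"
  by (induction e) (simp_all add: Var_times_single single_add[symmetric])

lemma (in primeideal) power_in_prime:
  assumes "a \<in> carrier R" "a [^] (n::nat) \<in> I"
  shows "a \<in> I"
  using assms(2)
proof (induction n)
  case 0
  then show ?case using I_notcarr one_imp_carrier by simp
next
  case (Suc n)
  then show ?case using I_prime[of "a [^] n" a] assms(1) by auto
qed

lemma poly_prime_power:
  fixes P :: "'k::comm_ring_1 mpoly set"
  assumes "primeideal P (poly_ring X)" "indets f \<subseteq> X" "f ^ n \<in> P"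
  shows "f \<in> P"
proof -
  have "f [^]\<^bsub>poly_ring X\<^esub> n = f ^ n"
    by (induction n) (simp_all add: nat_pow_def mult.commute)
  then show ?thesis using primeideal.power_in_prime[OF assms(1), of f n] assms(2,3) by simp
qed

lemma one_notin_poly_prime:
  fixes P :: "'k::comm_ring_1 mpoly set"
  assumes "primeideal P (poly_ring X)"
  shows "1 \<notin> P"
  using primeideal.I_notcarr[OF assms] ideal.one_imp_carrier[OF primeideal.axioms(1)[OF assms]]
  by auto

lemma poly_prime_prod:
  fixes P :: "'k::comm_ring_1 mpoly set"
  assumes P: "primeideal P (poly_ring X)"
    and g: "\<And>a. a \<in> S \<Longrightarrow> indets (g a) \<subseteq> X \<and> g a \<notin> P"
  shows "indets (prod g S) \<subseteq> X \<and> prod g S \<notin> P"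
  using g
proof (induction S rule: infinite_finite_induct)
  case (infinite S)
  then show ?case using one_notin_poly_prime[OF P] by simp
next
  case empty
  then show ?case using one_notin_poly_prime[OF P] by simp
next
  case (insert a S)
  then have "indets (g a) \<subseteq> X" "g a \<notin> P" "indets (prod g S) \<subseteq> X" "prod g S \<notin> P" by auto
  then have "g a * prod g S \<notin> P" "indets (g a * prod g S) \<subseteq> X"
    using primeideal.I_prime[OF P, of "g a" "prod g S"] indets_mult[of "g a" X "prod g S"] by auto
  then show ?case using insert.hyps by simp
qed

text \<open>The pair \<open>(A, e)\<close> stands for the \<open>e\<close>-th power of the prime generated by the variables in \<open>A\<close>.\<close>
abbreviation intersection_ideal ::
    "nat set \<Rightarrow> (nat set \<times> nat) set \<Rightarrow> 'k::comm_ring_1 mpoly set" where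
  "intersection_ideal X F \<equiv> mon_ideal X {m. \<forall>(A, e)\<in>F. e \<le> deg_in A m}"

lemma ideal_intersection_ideal: "ideal (intersection_ideal X F :: 'k::comm_ring_1 mpoly set) (poly_ring X)"
  by (rule ideal_mon_ideal) (auto intro: trans_le_add2)

text \<open>The prime \<open>P = I : h\<close> is a finite intersection of ideals \<open>\<qq>\<^bsup>e\<^esup> : h\<close> and hence contains one of them.
That one is proper, so \<open>h \<notin> \<qq>\<^bsup>e\<^esup>\<close>; containing a power of \<open>\<qq>\<close>, the prime \<open>P\<close> contains \<open>\<qq>\<close>; and as \<open>\<qq>\<^bsup>e\<^esup>\<close> is
\<open>\<qq>\<close>-primary, \<open>P \<subseteq> \<qq>\<^bsup>e\<^esup> : h \<subseteq> \<qq>\<close>.\<close>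
lemma associated_prime_of_intersection:
  fixes h :: "'k::field mpoly"
  assumes X: "finite X" and F: "finite F" "\<forall>(A, e)\<in>F. A \<subseteq> X"
    and P: "primeideal P (poly_ring X)" "P = {g. indets g \<subseteq> X \<and> g * h \<in> intersection_ideal X F}"
    and h: "indets h \<subseteq> X"
  shows "\<exists>A e. (A, e) \<in> F \<and> P = mon_power X A 1 \<and> h \<notin> mon_power X A e"
proof -
  interpret R: cring "poly_ring X :: 'k mpoly ring" by (rule cring_poly_ring)
  note idP = primeideal.axioms(1)[OF P(1)]
  note 1 = one_notin_poly_prime[OF P(1)]
  \<comment> \<open>otherwise pick an element of each colon ideal outside \<open>P\<close> and multiply them\<close>
  have "\<exists>(A, e)\<in>F. {g. indets g \<subseteq> X \<and> g * h \<in> mon_power X A e} \<subseteq> P"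
  proof (rule ccontr)
    assume "\<not> ?thesis"
    then have "\<forall>a\<in>F. \<exists>g. indets g \<subseteq> X \<and> g * h \<in> mon_power X (fst a) (snd a) \<and> g \<notin> P"
      by fastforce
    then obtain g where g: "\<And>a. a \<in> F \<Longrightarrow> indets (g a) \<subseteq> X"
      "\<And>a. a \<in> F \<Longrightarrow> g a * h \<in> mon_power X (fst a) (snd a)" "\<And>a. a \<in> F \<Longrightarrow> g a \<notin> P"
      by metis
    have pr: "indets (prod g F) \<subseteq> X" "prod g F \<notin> P"
      using poly_prime_prod[OF P(1), of F g] g by auto
    have "prod g F * h \<in> mon_power X (fst a) (snd a)" if a: "a \<in> F" for a
    proof -
      have "indets (prod g (F - {a})) \<subseteq> X"
        using poly_prime_prod[OF P(1), of "F - {a}" g] g by auto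
      from ideal_polyD(3)[OF ideal_mon_power this g(2)[OF a]]
      show ?thesis using a F(1) by (simp add: prod.remove[of F a] mult_ac)
    qed
    then have "prod g F * h \<in> intersection_ideal X F"
      using indets_mult[OF pr(1) h] by (fastforce simp: mon_ideal_def)
    then show False using pr P(2) by auto
  qed
  then obtain A e where Ae: "(A, e) \<in> F" "{g. indets g \<subseteq> X \<and> g * h \<in> mon_power X A e} \<subseteq> P"
    by auto
  have A: "A \<subseteq> X" "finite A" using F(2) Ae(1) finite_subset[OF _ X] by auto
  have hA: "h \<notin> mon_power X A e"
    using subsetD[OF Ae(2), of 1] 1 by auto
  have "Var a \<in> P" if a: "a \<in> A" for a
  proof -
    have "Var a ^ e * h \<in> mon_power X A e"
    proof -
      have "indets (Var a ^ e * h) \<subseteq> X"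
        unfolding Var_power using a A(1) h by (intro indets_mult indets_single) auto
      moreover have "e \<le> deg_in A m" if "m \<in> keys (Var a ^ e * h)" for m
        using that unfolding Var_power
        by (elim keys_mult_obtain) (use a A(2) in \<open>auto split: if_splits\<close>)
      ultimately show ?thesis by (auto simp: mon_ideal_def)
    qed
    moreover have "indets (Var a ^ e :: 'k mpoly) \<subseteq> X"
      unfolding Var_power using a A(1) by (intro indets_single) auto
    ultimately have "Var a ^ e \<in> P" using Ae(2) by auto
    then show ?thesis using poly_prime_power[OF P(1)] a A(1) by auto
  qed
  then have "mon_power X A 1 \<subseteq> P"
    unfolding genideal_Var[OF A(2,1), symmetric] by (intro R.genideal_minimal[OF idP]) auto
  moreover have "P \<subseteq> mon_power X A 1"
  proof
    fix g assume "g \<in> P"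
    then have g: "indets g \<subseteq> X" "g * h \<in> intersection_ideal X F" using P(2) by auto
    then have "g * h \<in> mon_power X A e" using Ae(1) by (auto simp: mon_ideal_def)
    then show "g \<in> mon_power X A 1" using mon_power_primary[OF g(1) _ h hA] by blast
  qed
  ultimately have "P = mon_power X A 1" by (rule subset_antisym[rotated])
  with Ae(1) hA show ?thesis by (intro exI conjI)
qed

lemma Ass_annihilator:
  fixes I :: "'k::comm_ring_1 mpoly set"
  assumes I: "ideal I (poly_ring X)" and P: "P \<in> Ass (poly_ring X) I"
  shows "primeideal P (poly_ring X)" "\<exists>h. indets h \<subseteq> X \<and> P = {g. indets g \<subseteq> X \<and> g * h \<in> I}"
proof -
  interpret I: ideal I "poly_ring X :: 'k mpoly ring" by (rule I)
  show "primeideal P (poly_ring X)" using P by (simp add: Ass_def)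
  obtain u where u: "u \<in> carrier (poly_ring X Quot I)"
    "P = {g \<in> carrier (poly_ring X). (I +>\<^bsub>poly_ring X\<^esub> g) \<otimes>\<^bsub>poly_ring X Quot I\<^esub> u
      = \<zero>\<^bsub>poly_ring X Quot I\<^esub>}"
    using P by (auto simp: Ass_def)
  obtain h where h: "h \<in> carrier (poly_ring X)" "u = I +>\<^bsub>poly_ring X\<^esub> h"
    using u(1) by (auto simp: FactRing_def A_RCOSETS_def')
  have "(I +>\<^bsub>poly_ring X\<^esub> g) \<otimes>\<^bsub>poly_ring X Quot I\<^esub> u = \<zero>\<^bsub>poly_ring X Quot I\<^esub> \<longleftrightarrow> g * h \<in> I"
    if g: "indets g \<subseteq> X" for g
  proof -
    have gh: "g * h \<in> carrier (poly_ring X)" using indets_mult[OF g] h(1) by simp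
    have "(I +>\<^bsub>poly_ring X\<^esub> g) \<otimes>\<^bsub>poly_ring X Quot I\<^esub> u = I +>\<^bsub>poly_ring X\<^esub> (g * h)"
      using I.rcoset_mult_add[of g h] g h by (simp add: FactRing_def)
    moreover have "I +>\<^bsub>poly_ring X\<^esub> (g * h) = I \<longleftrightarrow> g * h \<in> I"
      using I.a_rcos_zero[OF I] I.a_rcos_self[OF gh] by auto
    ultimately show ?thesis by (simp add: FactRing_def)
  qed
  then show "\<exists>h. indets h \<subseteq> X \<and> P = {g. indets g \<subseteq> X \<and> g * h \<in> I}"
    using h(1) u(2) by (intro exI[of _ h]) auto
qed


section \<open>Monomial localization\<close>

abbreviation restrict_to :: "nat set \<Rightarrow> (nat \<Rightarrow>\<^sub>0 nat) \<Rightarrow> (nat \<Rightarrow>\<^sub>0 nat)" where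
  "restrict_to A \<equiv> filter_keys (\<lambda>i. i \<in> A)"

lemma deg_in_restrict: "B \<subseteq> A \<Longrightarrow> deg_in B (restrict_to A m) = deg_in B m"
  unfolding deg_in_def by (rule sum.cong) (auto simp: lookup_filter_keys when_def)

lemma prod_single: "(\<Prod>i\<in>S. single (u i) (1 :: 'k::comm_ring_1)) = single (\<Sum>i\<in>S. u i) 1"
  by (induction S rule: infinite_finite_induct) (simp_all add: mult_single)

text \<open>The substitution of 1 for the variables outside \<open>A\<close>, one term at a time; terms
that become equal are added up.\<close>
definition localize :: "nat set \<Rightarrow> 'k::comm_ring_1 mpoly \<Rightarrow> 'k mpoly" where
  "localize A f = (\<Sum>m\<in>keys f. single (restrict_to A m) (lookup f m))"

lemma alg_hom_localize:
  fixes f :: "'k::comm_ring_1 mpoly"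
  shows "alg_hom (\<lambda>i. if i \<in> A then Var i else 1) f = localize A f"
proof -
  have "(\<Prod>i\<in>keys m. (if i \<in> A then Var i else (1 :: 'k mpoly)) ^ lookup m i) = single (restrict_to A m) 1" for m
  proof -
    have "(\<Prod>i\<in>keys m. (if i \<in> A then Var i else (1 :: 'k mpoly)) ^ lookup m i)
      = (\<Prod>i\<in>keys m. single (if i \<in> A then single i (lookup m i) else 0) 1)"
      by (rule prod.cong) (auto simp: Var_power)
    also have "\<dots> = single (\<Sum>i\<in>keys m. if i \<in> A then single i (lookup m i) else 0) 1"
      by (rule prod_single)
    also have "(\<Sum>i\<in>keys m. if i \<in> A then single i (lookup m i) else 0) = restrict_to A m"
    proof (rule poly_mapping_eqI)
      fix j
      have "lookup (\<Sum>i\<in>keys m. if i \<in> A then single i (lookup m i) else 0) j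
          = (\<Sum>i\<in>keys m. if i = j then (lookup m j when j \<in> A) else 0)"
        unfolding lookup_sum by (rule sum.cong) (auto simp: lookup_single when_def)
      then show "lookup (\<Sum>i\<in>keys m. if i \<in> A then single i (lookup m i) else 0) j
          = lookup (restrict_to A m) j"
        by (auto simp: lookup_filter_keys when_def in_keys_iff)
    qed
    finally show ?thesis .
  qed
  then show ?thesis by (simp add: alg_hom_def localize_def Const_def mult_single)
qed

lemma localize_add: "localize A (f + g) = localize A f + localize A g"
  unfolding localize_def by (rule setsum_keys_plus_distrib) (simp_all add: single_add)

lemma localize_single: "localize A (single m c) = single (restrict_to A m) c"
  by (simp add: localize_def)

lemma localize_zero: "localize A 0 = 0"
  by (simp add: localize_def)

lemma localize_sum: "localize A (sum f S) = (\<Sum>a\<in>S. localize A (f a))"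
  by (induction S rule: infinite_finite_induct) (simp_all add: localize_add localize_zero)

lemma keys_localize: "keys (localize A f) \<subseteq> restrict_to A ` keys f"
proof
  fix m assume "m \<in> keys (localize A f)"
  then have "(\<Sum>m'\<in>keys f. lookup (single (restrict_to A m') (lookup f m')) m) \<noteq> 0"
    by (simp add: localize_def lookup_sum in_keys_iff)
  then obtain m' where "m' \<in> keys f" "lookup (single (restrict_to A m') (lookup f m')) m \<noteq> 0"
    by (meson sum.neutral)
  then show "m \<in> restrict_to A ` keys f" by (auto simp: lookup_single when_def split: if_splits)
qed

text \<open>Localizing drops the components that involve a variable outside \<open>A\<close>. To lift an element,
multiply it by a high power of all variables outside \<open>A\<close>: this puts it into all of these components, does not
change the degree in any \<open>B \<subseteq> A\<close>, and is undone by the substitution.\<close>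
lemma mon_localization_intersection_ideal:
  fixes F :: "(nat set \<times> nat) set"
  assumes X: "finite X" and F: "finite F" "\<forall>(B, e)\<in>F. B \<subseteq> X" and A: "A \<subseteq> X"
  shows "mon_localization (mon_power X A 1) (intersection_ideal X F :: 'k::comm_ring_1 mpoly set)
    = intersection_ideal A {(B, e) \<in> F. B \<subseteq> A}"
proof -
  have "finite A" using A X finite_subset by blast
  have loc: "mon_localization (mon_power X A 1) I = localize A ` I" for I :: "'k mpoly set"
    unfolding mon_localization_def Var_in_mon_power[OF \<open>finite A\<close> A] alg_hom_localize
    by (rule refl)
  show ?thesis
    unfolding loc
  proof
    show "localize A ` intersection_ideal X F
      \<subseteq> (intersection_ideal A {(B, e) \<in> F. B \<subseteq> A} :: 'k mpoly set)"
    proof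
      fix g :: "'k mpoly" assume "g \<in> localize A ` intersection_ideal X F"
      then obtain f where f: "f \<in> intersection_ideal X F" "g = localize A f" by blast
      have "keys m \<subseteq> A \<and> (\<forall>(B, e)\<in>{(B, e) \<in> F. B \<subseteq> A}. e \<le> deg_in B m)" if "m \<in> keys g" for m
      proof -
        obtain m' where m': "m' \<in> keys f" "m = restrict_to A m'"
          using keys_localize[of A f] \<open>m \<in> keys g\<close> f(2) by blast
        have "e \<le> deg_in B m" if "(B, e) \<in> F" "B \<subseteq> A" for B e
          using f(1) m'(1) that unfolding m'(2) deg_in_restrict[OF that(2)]
          by (auto simp: mon_ideal_def)
        then show ?thesis unfolding m'(2) by auto
      qed
      then show "g \<in> intersection_ideal A {(B, e) \<in> F. B \<subseteq> A}"
        by (auto simp: mon_ideal_def indets_subset_iff)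
    qed
    show "(intersection_ideal A {(B, e) \<in> F. B \<subseteq> A} :: 'k mpoly set)
      \<subseteq> localize A ` intersection_ideal X F"
    proof
      fix f :: "'k mpoly" assume f: "f \<in> intersection_ideal A {(B, e) \<in> F. B \<subseteq> A}"
      \<comment> \<open>the sum is a convenient upper bound for all exponents\<close>
      define N where "N = (\<Sum>(B, e)\<in>F. e)"
      have N: "e \<le> N" if "(B, e) \<in> F" for B e
        unfolding N_def using member_le_sum[of "(B, e)" F "\<lambda>(B, e). e"] that F(1) by auto
      define t where "t = (\<Sum>i\<in>X - A. single i N)"
      have t: "lookup t i = (if i \<in> X - A then N else 0)" for i
        using X by (auto simp: t_def lookup_sum lookup_single when_def)
      define g where "g = (\<Sum>m\<in>keys f. single (t + m) (lookup f m))"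
      have fA: "keys m \<subseteq> A" if "m \<in> keys f" for m
        using f that by (auto simp: mon_ideal_def indets_subset_iff)
      have "g \<in> intersection_ideal X F"
        unfolding g_def
      proof (rule ideal_poly_sum[OF ideal_intersection_ideal])
        fix m assume m: "m \<in> keys f"
        have "e \<le> deg_in B (t + m)" if Be: "(B, e) \<in> F" for B e
        proof (cases "B \<subseteq> A")
          case True
          then have "e \<le> deg_in B m" using f m Be by (auto simp: mon_ideal_def)
          then show ?thesis by simp
        next
          case False
          then obtain b where b: "b \<in> B" "b \<notin> A" by blast
          have BX: "B \<subseteq> X" using F(2) Be by blast
          then have "lookup t b = N" using b by (auto simp: t)
          moreover have "finite B" using BX X finite_subset by blast
          then have "lookup t b \<le> deg_in B t"
            unfolding deg_in_def using b(1) by (intro member_le_sum) auto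
          ultimately show ?thesis using N[OF Be] by simp
        qed
        moreover have "keys t \<subseteq> X" by (auto simp: in_keys_iff t split: if_splits)
        then have "keys (t + m) \<subseteq> X" using fA[OF m] A by (auto simp: keys_add_nat)
        ultimately show "single (t + m) (lookup f m) \<in> intersection_ideal X F"
          by (auto simp: mon_ideal_def indets_subset_iff)
      qed
      moreover have "localize A g = f"
      proof -
        have "restrict_to A (t + m) = m" if "m \<in> keys f" for m
          by (rule poly_mapping_eqI)
             (use fA[OF that] in \<open>auto simp: lookup_filter_keys lookup_add t when_def in_keys_iff\<close>)
        then have "localize A g = (\<Sum>m\<in>keys f. single m (lookup f m))"
          by (simp add: g_def localize_sum localize_single)
        then show ?thesis using poly_mapping_sum_single[of f] by simp
      qed
      ultimately show "f \<in> localize A ` intersection_ideal X F" by blast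
    qed
  qed
qed

text \<open>The substitution may cancel terms but creates none, so every monomial of the localization comes from one of
the original ideal. This transports the socle monomial back to the ideal.\<close>
lemma mon_localization_keys:
  assumes "g \<in> mon_localization (mon_power X A 1) I" "m \<in> keys g" "finite A" "A \<subseteq> X"
  shows "\<exists>f\<in>I. \<exists>m'\<in>keys f. restrict_to A m' = m"
proof -
  obtain f where "f \<in> I" "g = localize A f"
    using assms(1) unfolding mon_localization_def Var_in_mon_power[OF assms(3,4)] alg_hom_localize
    by blast
  then show ?thesis using keys_localize[of A f] assms(2) by blast
qed

lemma keys_Var_times: "m \<in> keys f \<Longrightarrow> single i 1 + m \<in> keys (Var i * f)"
proof -
  assume m: "m \<in> keys f"
  have "Var i * f = (\<Sum>m'\<in>keys f. single (single i 1 + m') (lookup f m'))"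
    by (subst poly_mapping_sum_single) (simp add: sum_distrib_left Var_times_single)
  then have "lookup (Var i * f) (single i 1 + m) = lookup f m"
    using m by (simp add: lookup_sum lookup_single when_def)
  then show ?thesis using m by (simp add: in_keys_iff)
qed

section \<open>The socle of the localization\<close>

text \<open>Since \<open>h \<notin> P\<^bsup>d\<^esup>\<close>, some monomial \<open>m\<close> of \<open>h\<close> has \<open>A\<close>-degree less than \<open>d\<close>. For a component \<open>(B, e)\<close> with \<open>B \<subset> A\<close> choose
\<open>a \<in> A - B\<close>; then \<open>x\<^sub>a h \<in> I\<close>, and \<open>x\<^sub>a\<close> does not count for the \<open>B\<close>-degree, so \<open>m\<close> has \<open>B\<close>-degree at least \<open>e\<close>. Only
the component \<open>(A, d)\<close> is violated by the restriction of \<open>m\<close> to \<open>A\<close>, and after padding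
it to degree \<open>d - 1\<close> it is violated by exactly one.\<close>
lemma socle_monomial:
  fixes h :: "'k::field mpoly"
  assumes X: "finite X" and F: "finite F" "\<forall>(B, e)\<in>F. B \<subseteq> X"
    and A: "(A, d) \<in> F" "\<forall>e. (A, e) \<in> F \<longrightarrow> e = d" "A \<noteq> {}" "d \<ge> 1"
    and P: "mon_power X A 1 = {g. indets g \<subseteq> X \<and> g * h \<in> intersection_ideal X F}"
    and h: "indets h \<subseteq> X" "h \<notin> mon_power X A d"
  shows "\<exists>m0. keys m0 \<subseteq> A \<and> Suc (mon_deg m0) = d \<and>
    single m0 (1::'k) \<notin> intersection_ideal A {(B, e) \<in> F. B \<subseteq> A} \<and>
    (\<forall>a\<in>A. Var a * single m0 (1::'k) \<in> intersection_ideal A {(B, e) \<in> F. B \<subseteq> A})"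
proof -
  have AX: "A \<subseteq> X" "finite A" using F(2) A(1) finite_subset[OF _ X] by auto
  obtain m where m: "m \<in> keys h" "deg_in A m < d"
    using h by (force simp: mon_ideal_def not_le)
  have small: "e \<le> deg_in B m" if Be: "(B, e) \<in> F" "B \<subset> A" for B e
  proof -
    obtain a where a: "a \<in> A" "a \<notin> B" using Be(2) by blast
    then have "Var a \<in> (mon_power X A 1 :: 'k mpoly set)" using Var_in_mon_power[OF AX(2,1)] by blast
    then have "Var a * h \<in> intersection_ideal X F" unfolding P by simp
    then have "\<forall>(B, e)\<in>F. e \<le> deg_in B (single a 1 + m)"
      using keys_Var_times[OF m(1), of a] unfolding mon_ideal_def by blast
    then have "e \<le> deg_in B (single a 1 + m)" using Be(1) by blast
    moreover have "finite B" using Be(2) AX(2) finite_subset by blast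
    ultimately show ?thesis using a(2) by simp
  qed
  obtain a0 where a0: "a0 \<in> A" using A(3) by blast
  define m0 where "m0 = restrict_to A m + single a0 (d - 1 - deg_in A m)"
  have keys: "keys m0 \<subseteq> A" using a0 by (auto simp: m0_def keys_add_nat)
  have deg: "Suc (deg_in A m0) = d"
    using m(2) a0 AX(2) by (simp add: m0_def deg_in_restrict)
  have ge: "deg_in B m \<le> deg_in B m0" if "B \<subseteq> A" for B
    by (simp add: m0_def deg_in_restrict[OF that])
  have "\<not> d \<le> deg_in A m0" using deg by simp
  then have "single m0 (1::'k) \<notin> intersection_ideal A {(B, e) \<in> F. B \<subseteq> A}"
    using A(1) by (auto simp: mon_ideal_def)
  moreover have "Var a * single m0 (1::'k) \<in> intersection_ideal A {(B, e) \<in> F. B \<subseteq> A}"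
    if a: "a \<in> A" for a
  proof -
    have "e \<le> deg_in B (single a 1 + m0)" if Be: "(B, e) \<in> F" "B \<subseteq> A" for B e
    proof (cases "B = A")
      case True
      then show ?thesis using A(2) Be deg a AX(2) by simp
    next
      case False
      then have "e \<le> deg_in B m" using small Be by blast
      then show ?thesis using ge[OF Be(2)] by simp
    qed
    then show ?thesis
      using a keys by (auto simp: Var_times_single mon_ideal_def indets_subset_iff keys_add_nat)
  qed
  ultimately show ?thesis
    using keys deg mon_deg_eq_deg_in[OF AX(2) keys] by auto
qed

text \<open>The results on socle elements, applied to the localization at \<open>P\<close>. The third conclusion says that \<open>P\<^bsup>d + 1\<^esup>\<close>
does not contain \<open>I\<close>; it is what determines the exponents of the presentation.\<close>
theorem localization_regularity:
  fixes I :: "'k::field mpoly set"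
  assumes X: "finite X" and F: "finite F" "\<forall>(B, e)\<in>F. B \<subseteq> X"
    and A: "(A, d) \<in> F" "\<forall>e. (A, e) \<in> F \<longrightarrow> e = d" "d \<ge> 1"
    and I: "I = intersection_ideal X F" "I \<noteq> {0}"
    and P: "mon_power X A 1 = {g. indets g \<subseteq> X \<and> g * h \<in> I}"
    and h: "indets h \<subseteq> X" "h \<notin> mon_power X A d"
  shows "int d \<le> reg A (mon_localization (mon_power X A 1) I)"
    and "int d = reg A (mon_localization (mon_power X A 1) I) \<longleftrightarrow>
      linear_resolution A (mon_localization (mon_power X A 1) I)"
    and "\<exists>f\<in>I. \<exists>m\<in>keys f. deg_in A m = d"
proof -
  have AX: "A \<subseteq> X" "finite A" using F(2) A(1) finite_subset[OF _ X] by auto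
  \<comment> \<open>if \<open>P\<close> were the zero ideal, the component \<open>P\<^bsup>d\<^esup>\<close> would make \<open>I\<close> zero\<close>
  have "A \<noteq> {}"
  proof
    assume "A = {}"
    have "f = 0" if "f \<in> I" for f
    proof -
      have "d \<le> 0" if "m \<in> keys f" for m
        using that \<open>f \<in> I\<close> A(1) \<open>A = {}\<close> by (fastforce simp: I(1) mon_ideal_def deg_in_def)
      then have "keys f = {}" using A(3) by fastforce
      then show ?thesis by simp
    qed
    moreover have "0 \<in> I" by (simp add: I(1) mon_ideal_def)
    ultimately show False using I(2) by blast
  qed
  let ?J = "mon_localization (mon_power X A 1) I"
  let ?FA = "{(B, e) \<in> F. B \<subseteq> A}"
  have J: "?J = intersection_ideal A ?FA"
    unfolding I(1) by (rule mon_localization_intersection_ideal[OF X F AX(1)])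
  obtain m0 where m0: "keys m0 \<subseteq> A" "Suc (mon_deg m0) = d" "single m0 1 \<notin> ?J"
    "\<And>a. a \<in> A \<Longrightarrow> Var a * single m0 1 \<in> ?J"
    using socle_monomial[OF X F A(1,2) \<open>A \<noteq> {}\<close> A(3) P[unfolded I(1)] h] unfolding J by blast
  have deg: "d \<le> mon_deg m" if "m \<in> {m. \<forall>(B, e)\<in>?FA. e \<le> deg_in B m}" "keys m \<subseteq> A" for m
    using that A(1) by (auto simp: mon_deg_eq_deg_in[OF AX(2)])
  have idJ: "ideal ?J (poly_ring A)" unfolding J by (rule ideal_intersection_ideal)
  show "int d \<le> reg A ?J" "int d = reg A ?J \<longleftrightarrow> linear_resolution A ?J"
    using regularity_of_socle[OF AX(2) \<open>A \<noteq> {}\<close> idJ J deg m0] by blast+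
  obtain a where a: "a \<in> A" using \<open>A \<noteq> {}\<close> by blast
  have "single a 1 + m0 \<in> keys (Var a * single m0 (1::'k))" by (simp add: Var_times_single)
  then obtain f m where "f \<in> I" "m \<in> keys f" "restrict_to A m = single a 1 + m0"
    using mon_localization_keys[OF m0(4)[OF a] _ AX(2,1)] by blast
  moreover from this have "deg_in A m = d"
    using deg_in_restrict[of A A m] m0(1,2) a AX(2) by (simp add: mon_deg_eq_deg_in)
  ultimately show "\<exists>f\<in>I. \<exists>m\<in>keys f. deg_in A m = d" by blast
qed

section \<open>The exponents of an ideal of intersection type\<close>
lemma monomial_prime_eq_mon_power:
  assumes "finite X" "monomial_prime X (P :: 'k::comm_ring_1 mpoly set)"
  shows "P = mon_power X (vars_of X P) 1" "vars_of X P \<subseteq> X"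
proof -
  obtain A where A: "A \<subseteq> X" "P = Idl\<^bsub>poly_ring X\<^esub> (Var ` A)"
    using assms(2) by (auto simp: monomial_prime_def)
  have fA: "finite A" using A(1) assms(1) finite_subset by blast
  have P: "P = mon_power X A 1" using A(2) genideal_Var[OF fA A(1)] by simp
  have "vars_of X P = A" using Var_in_mon_power[OF fA A(1)] A(1) unfolding P vars_of_def by blast
  then show "P = mon_power X (vars_of X P) 1" "vars_of X P \<subseteq> X" using P A(1) by simp_all
qed

lemma vars_of_mon_power:
  assumes "finite X" "A \<subseteq> X"
  shows "vars_of X (mon_power X A 1 :: 'k::comm_ring_1 mpoly set) = A"
  using Var_in_mon_power[OF finite_subset[OF assms(2,1)] assms(2)] assms(2)
  unfolding vars_of_def by blast

lemma Inter_mon_power: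
  "carrier (poly_ring X) \<inter> (\<Inter>(A, e)\<in>F. mon_power X A e) = intersection_ideal X F"
  by (auto simp: mon_ideal_def)

lemma intersection_type_explicit:
  fixes I :: "'k::comm_ring_1 mpoly set"
  assumes X: "finite X" and I: "intersection_type X I"
  shows "\<exists>F. finite F \<and> (\<forall>(A, e)\<in>F. A \<subseteq> X) \<and> I = intersection_ideal X F"
proof -
  obtain F where F: "finite F" "\<And>P e. (P, e) \<in> F \<Longrightarrow> monomial_prime X P"
    "I = carrier (poly_ring X) \<inter> (\<Inter>(P, e)\<in>F. ideal_pow (poly_ring X) P e)"
    using I by (auto simp: intersection_type_def)
  have pow: "ideal_pow (poly_ring X) P e = mon_power X (vars_of X P) e" if "(P, e) \<in> F" for P e
    using monomial_prime_eq_mon_power[OF X F(2)[OF that]] finite_subset[OF _ X]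
      ideal_pow_mon_power[of "vars_of X P" X e, where 'k='k] by simp
  let ?F = "(\<lambda>(P, e). (vars_of X P, e)) ` F"
  have "(\<Inter>(P, e)\<in>F. ideal_pow (poly_ring X) P e) = (\<Inter>(P, e)\<in>F. mon_power X (vars_of X P) e)"
    using pow by (intro INF_cong) auto
  also have "\<dots> = (\<Inter>(A, e)\<in>?F. mon_power X A e)" by (simp add: image_image case_prod_unfold)
  finally have "I = intersection_ideal X ?F" using F(3) by (simp only: Inter_mon_power)
  moreover have "\<forall>(A, e)\<in>?F. A \<subseteq> X" by (auto simp: vars_of_def)
  ultimately show ?thesis using F(1) by (intro exI[of _ ?F]) simp
qed

theorem theorem1p3:
  fixes n :: nat
    and I :: "'k::field mpoly set"
    and d :: "'k mpoly set \<Rightarrow> nat"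
  assumes "monomial_ideal {1..n} I"
    and "I \<noteq> {0}"
    and "intersection_type {1..n} I"
    and "\<And>P. P \<in> Ass (poly_ring {1..n}) I \<Longrightarrow> d P \<ge> 1"
    and "I = carrier (poly_ring {1..n}) \<inter>
           (\<Inter>P\<in>Ass (poly_ring {1..n}) I. ideal_pow (poly_ring {1..n}) P (d P))"
  shows "(\<forall>P\<in>Ass (poly_ring {1..n}) I.
            int (d P) \<le> reg (vars_of {1..n} P) (mon_localization P I)) \<and>
         (\<forall>P\<in>Ass (poly_ring {1..n}) I.
            int (d P) = reg (vars_of {1..n} P) (mon_localization P I) \<longleftrightarrow>
            linear_resolution (vars_of {1..n} P) (mon_localization P I)) \<and>
         (I = carrier (poly_ring {1..n}) \<inter>
            (\<Inter>P\<in>Ass (poly_ring {1..n}) I.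
               ideal_pow (poly_ring {1..n}) P
                 (nat (reg (vars_of {1..n} P) (mon_localization P I)))) \<longleftrightarrow>
          (\<forall>P\<in>Ass (poly_ring {1..n}) I.
            linear_resolution (vars_of {1..n} P) (mon_localization P I)))"
proof -
  define X where "X = {1..n}"
  have X: "finite X" by (simp add: X_def)
  let ?R = "poly_ring X :: 'k mpoly ring"
  define r where "r P = reg (vars_of X P) (mon_localization P I)" for P
  note d = assms(4)[folded X_def]
  note I = assms(5)[folded X_def]
  obtain F0 where F0: "finite F0" "\<forall>(A, e)\<in>F0. A \<subseteq> X" "I = intersection_ideal X F0"
    using intersection_type_explicit[OF X assms(3)[folded X_def]] by fast
  have idI: "ideal I ?R" unfolding F0(3) by (rule ideal_intersection_ideal)
  have ann: "\<exists>h. indets h \<subseteq> X \<and> P = {g. indets g \<subseteq> X \<and> g * h \<in> I}"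
    and prime: "primeideal P ?R" if "P \<in> Ass ?R I" for P
    using Ass_annihilator[OF idI that] by blast+
  \<comment> \<open>Any finite presentation shows that the associated primes are monomial and finite in number. Only then can
    the presentation with the exponents \<open>d\<close>, which is indexed by them, be used in the same way.\<close>
  have mono: "\<exists>A e. (A, e) \<in> F0 \<and> P = mon_power X A 1" if P: "P \<in> Ass ?R I" for P
  proof -
    obtain h where h: "indets h \<subseteq> X" "P = {g. indets g \<subseteq> X \<and> g * h \<in> I}" using ann[OF P] by blast
    obtain A e where "(A, e) \<in> F0" "P = mon_power X A 1"
      using associated_prime_of_intersection[OF X F0(1,2) prime[OF P] h(2)[unfolded F0(3)] h(1)]
      by (elim exE conjE)
    then show ?thesis by (intro exI conjI)
  qed
  have "Ass ?R I \<subseteq> (\<lambda>(A, e). mon_power X A 1) ` F0"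
  proof
    fix P assume "P \<in> Ass ?R I"
    from mono[OF this] obtain A e where "(A, e) \<in> F0" "P = mon_power X A 1" by (elim exE conjE)
    then show "P \<in> (\<lambda>(A, e). mon_power X A 1) ` F0" by (intro image_eqI[of _ _ "(A, e)"]) simp_all
  qed
  then have finAss: "finite (Ass ?R I)" by (rule finite_subset[OF _ finite_imageI[OF F0(1)]])
  have Pvars: "vars_of X P \<subseteq> X" for P :: "'k mpoly set" by (auto simp: vars_of_def)
  have Peq: "P = mon_power X (vars_of X P) 1" if P: "P \<in> Ass ?R I" for P
  proof -
    obtain A e where A: "(A, e) \<in> F0" "P = mon_power X A 1" using mono[OF P] by (elim exE conjE)
    then have "A \<subseteq> X" using F0(2) by blast
    then show ?thesis unfolding A(2) by (simp only: vars_of_mon_power[OF X])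
  qed
  have pow: "ideal_pow ?R P e = mon_power X (vars_of X P) e" if "P \<in> Ass ?R I" for P e
    using Peq[OF that] ideal_pow_mon_power[OF finite_subset[OF Pvars X] Pvars, of P e, where 'k='k]
    by simp
  define F where "F = (\<lambda>P. (vars_of X P, d P)) ` Ass ?R I"
  have F: "finite F" "\<forall>(A, e)\<in>F. A \<subseteq> X"
    using finAss Pvars by (auto simp: F_def)
  have IF: "I = intersection_ideal X F"
  proof -
    have "(\<Inter>P\<in>Ass ?R I. ideal_pow ?R P (d P)) = (\<Inter>(A, e)\<in>F. mon_power X A e)"
      using pow by (simp add: F_def image_image)
    then show ?thesis using I by (simp only: Inter_mon_power)
  qed
  have main: "int (d P) \<le> r P \<and> (int (d P) = r P \<longleftrightarrow> linear_resolution (vars_of X P) (mon_localization P I))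
      \<and> (\<exists>f\<in>I. \<exists>m\<in>keys f. deg_in (vars_of X P) m = d P)" if P: "P \<in> Ass ?R I" for P
  proof -
    obtain h where h: "indets h \<subseteq> X" "P = {g. indets g \<subseteq> X \<and> g * h \<in> I}" using ann[OF P] by blast
    obtain A e where A: "(A, e) \<in> F" "P = mon_power X A 1" "h \<notin> mon_power X A e"
      using associated_prime_of_intersection[OF X F prime[OF P] h(2)[unfolded IF] h(1)]
      by (elim exE conjE)
    have "A \<subseteq> X" using F(2) A(1) by blast
    then have vA: "vars_of X P = A" unfolding A(2) by (rule vars_of_mon_power[OF X])
    have uniq: "e' = d P" if "(A, e') \<in> F" for e'
    proof -
      obtain P' where P': "P' \<in> Ass ?R I" "vars_of X P' = A" "e' = d P'" using \<open>(A, e') \<in> F\<close> by (auto simp: F_def)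
      then have "P' = P" using Peq[OF P'(1)] A(2) by simp
      then show ?thesis using P'(3) by simp
    qed
    have e: "e = d P" using uniq A(1) .
    note L = localization_regularity[OF X F A(1)[unfolded e] _ d[OF P] IF assms(2)
        h(2)[unfolded A(2)] h(1) A(3)[unfolded e]]
    show ?thesis using L[folded A(2)] uniq by (simp add: r_def vA)
  qed
  have third: "I = carrier ?R \<inter> (\<Inter>P\<in>Ass ?R I. ideal_pow ?R P (nat (r P))) \<longleftrightarrow>
    (\<forall>P\<in>Ass ?R I. linear_resolution (vars_of X P) (mon_localization P I))"
  proof
    assume eq: "I = carrier ?R \<inter> (\<Inter>P\<in>Ass ?R I. ideal_pow ?R P (nat (r P)))"
    show "\<forall>P\<in>Ass ?R I. linear_resolution (vars_of X P) (mon_localization P I)"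
    proof
      fix P assume P: "P \<in> Ass ?R I"
      obtain f m where f: "f \<in> I" "m \<in> keys f" "deg_in (vars_of X P) m = d P" using main[OF P] by blast
      then have "f \<in> mon_power X (vars_of X P) (nat (r P))" using eq P pow[OF P] by blast
      then have "nat (r P) \<le> d P" using f(2,3) by (auto simp: mon_ideal_def)
      then show "linear_resolution (vars_of X P) (mon_localization P I)"
        using main[OF P] by linarith
    qed
  next
    assume "\<forall>P\<in>Ass ?R I. linear_resolution (vars_of X P) (mon_localization P I)"
    then have "nat (r P) = d P" if "P \<in> Ass ?R I" for P using main[OF that] that by (metis nat_int)
    then show "I = carrier ?R \<inter> (\<Inter>P\<in>Ass ?R I. ideal_pow ?R P (nat (r P)))"
      using I by simp
  qed
  show ?thesis
    unfolding X_def[symmetric]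
    using main third unfolding r_def by blast
qed

end
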